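(* Let $\Bbbk$ be an algebraically closed field of characteristic $0$, and let $(R,\mathfrak{m},\Bbbk)$ be a non-regular complete Noetherian local domain of dimension one which is a $\Bbbk$-algebra (with residue field $\Bbbk$). Let $\Omega_R$ be the module of differentials of $R$ over $\Bbbk$, let $\overline{R}=\Bbbk[[t]]$ be the integral closure of $R$ in its fraction field, and let $v$ be the $t$-adic order valuation. Then $R$ is quasihomogeneous if and only if $$v(\operatorname{tr}_R(\Omega_R))=v(\mathfrak{m}).$$
   Context: Setting: $R$ can be written as $R=P/I$ with $P=\Bbbk[[X_1,\ldots,X_n]]$, $n\geq 2$, and $I=(f_1,\ldots,f_m)\subseteq (X_1,\ldots,X_n)^2$ a prime ideal. Let $Q=\operatorname{Frac}(R)$. The integral closure $\overline{R}$ of $R$ in $Q$ is a discrete valuation ring; fix a uniformizing parameter $t$, so $\overline{R}=\Bbbk[[t]]$ and $R\subseteq\Bbbk[[t]]$. Order valuation: for $p=\sum_{i\geq 0}c_it^i\in\Bbbk[[t]]$, $v(p)=\min\{i\mid c_i\neq 0\}$, with $v(0)=\infty$; it extends to $Q$ by $v(p/q)=v(p)-v(q)$. For a fractional ideal $J$ of $R$ (a finitely generated $R$-submodule of $Q$), in particular for an ideal of $R$, $v(J)=\min\{v(y)\mid y\in J\}$. Module of differentials: $\Omega_R$ denotes the universally finite module of differentials of $R$ over $\Bbbk$, i.e. the $R$-module with presentation $$R^m\xrightarrow{\left[\frac{\partial f_j}{\partial x_i}\right]}R^n\to\Omega_R\to 0,$$ where the matrix is the Jacobian matrix of $f_1,\ldots,f_m$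 with entries taken in $R$. Trace ideal: for a finitely generated $R$-module $M$, $\operatorname{tr}_R(M)=\sum_{\alpha\in\operatorname{Hom}_R(M,R)}\alpha(M)$, an ideal of $R$. Quasihomogeneous: $R$ is called quasihomogeneous if there exists a surjective $R$-module homomorphism $\Omega_R\to\mathfrak{m}$. *)

theory Defs
  imports
    "HOL-Analysis.Finite_Cartesian_Product"
    "HOL-Library.Extended_Nat"
    "HOL-Algebra.Ideal_Product"
    "HOL-Algebra.QuotRing"
    "HOL-Algebra.Ring_Divisibility"
    "HOL-Algebra.Module"
    "HOL-Algebra.Algebraic_Closure_Type"
    "HOL-Computational_Algebra.Formal_Power_Series"
    "HOL-Computational_Algebra.Polynomial_Factorial"
begin

section \<open>Formal power series in several variables\<close>

text \<open>
  The variables are indexed by the type \<open>'n\<close>, and a monomial is the multiset of its variables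
  (counted with exponents), so that the product of monomials is the sum of multisets.
\<close>

typedef ('a, 'n) mfps = "UNIV :: ('n multiset \<Rightarrow> 'a) set"
  morphisms mfps_nth Abs_mfps
  by simp

setup_lifting type_definition_mfps

lemma mfps_eqI: "(\<And>A. mfps_nth f A = mfps_nth g A) \<Longrightarrow> f = g"
  by (simp add: mfps_nth_inject[symmetric] fun_eq_iff)

lemma finite_submultisets: "finite {B. B \<subseteq># (A :: 'n multiset)}"
proof (induction A)
  case empty
  then show ?case by simp
next
  case (add x A)
  have "{B. B \<subseteq># add_mset x A} \<subseteq> {B. B \<subseteq># A} \<union> add_mset x ` {B. B \<subseteq># A}"
  proof
    fix B assume "B \<in> {B. B \<subseteq># add_mset x A}"
    then have B: "B \<subseteq># add_mset x A" by simp
    show "B \<in> {B. B \<subseteq># A} \<union> add_mset x ` {B. B \<subseteq># A}"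
    proof (cases "x \<in># B")
      case True
      then obtain C where "B = add_mset x C" by (meson multi_member_split)
      with B show ?thesis by auto
    next
      case False
      with B have "B \<subseteq># A"
        by (metis Diff_eq_empty_iff_mset diff_add_mset_swap diff_empty diff_single_trivial
              add_mset_remove_trivial subset_eq_diff_conv add_mset_add_single)
      then show ?thesis by simp
    qed
  qed
  with add show ?case by (meson finite_UnI finite_imageI finite_subset)
qed

lemma finite_mset_splits: "finite {(B, C). B + C = (A :: 'n multiset)}"
proof -
  have "{(B, C). B + C = A} \<subseteq> {B. B \<subseteq># A} \<times> {B. B \<subseteq># A}"
    by auto
  then show ?thesis
    by (rule finite_subset) (intro finite_cartesian_product finite_submultisets)
qed

instantiation mfps :: (comm_ring_1, type) comm_ring_1
begin

lift_definition zero_mfps :: "('a, 'n) mfps" is "\<lambda>_. 0" .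

lift_definition one_mfps :: "('a, 'n) mfps" is "\<lambda>A. if A = {#} then 1 else 0" .

lift_definition plus_mfps :: "('a, 'n) mfps \<Rightarrow> ('a, 'n) mfps \<Rightarrow> ('a, 'n) mfps"
  is "\<lambda>f g A. f A + g A" .

lift_definition minus_mfps :: "('a, 'n) mfps \<Rightarrow> ('a, 'n) mfps \<Rightarrow> ('a, 'n) mfps"
  is "\<lambda>f g A. f A - g A" .

lift_definition uminus_mfps :: "('a, 'n) mfps \<Rightarrow> ('a, 'n) mfps"
  is "\<lambda>f A. - f A" .

lift_definition times_mfps :: "('a, 'n) mfps \<Rightarrow> ('a, 'n) mfps \<Rightarrow> ('a, 'n) mfps"
  is "\<lambda>f g A. \<Sum>(B, C) | B + C = A. f B * g C" .

instance
proof
  fix f g h :: "('a, 'n) mfps"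
  show "f * g * h = f * (g * h)"
  proof (rule mfps_eqI)
    fix A :: "'n multiset"
    let ?f = "mfps_nth f" and ?g = "mfps_nth g" and ?h = "mfps_nth h"
    let ?S = "\<lambda>A :: 'n multiset. {(B, C). B + C = A}"
    have fin: "\<forall>x\<in>?S A. finite (?S (fst x))" "\<forall>x\<in>?S A. finite (?S (snd x))"
      using finite_mset_splits by auto
    have "mfps_nth (f * g * h) A = (\<Sum>x\<in>?S A. \<Sum>y\<in>?S (fst x). ?f (fst y) * ?g (snd y) * ?h (snd x))"
      by (simp add: times_mfps.rep_eq sum_distrib_right case_prod_beta)
    also have "\<dots> = (\<Sum>(x, y)\<in>Sigma (?S A) (\<lambda>x. ?S (fst x)). ?f (fst y) * ?g (snd y) * ?h (snd x))"
      using finite_mset_splits fin by (subst sum.Sigma) auto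
    also have "\<dots> = (\<Sum>(x, y)\<in>Sigma (?S A) (\<lambda>x. ?S (snd x)). ?f (fst x) * (?g (fst y) * ?h (snd y)))"
      by (rule sum.reindex_bij_witness
            [where i = "\<lambda>((a, b), (c, d)). ((a + c, d), (a, c))"
               and j = "\<lambda>((a, b), (c, d)). ((c, d + b), (d, b))"])
         (auto simp: algebra_simps)
    also have "\<dots> = (\<Sum>x\<in>?S A. \<Sum>y\<in>?S (snd x). ?f (fst x) * (?g (fst y) * ?h (snd y)))"
      using finite_mset_splits fin by (subst sum.Sigma) auto
    also have "\<dots> = mfps_nth (f * (g * h)) A"
      by (simp add: times_mfps.rep_eq sum_distrib_left case_prod_beta)
    finally show "mfps_nth (f * g * h) A = mfps_nth (f * (g * h)) A" .
  qed
  show "f * g = g * f"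
  proof (rule mfps_eqI)
    fix A :: "'n multiset"
    show "mfps_nth (f * g) A = mfps_nth (g * f) A"
      unfolding times_mfps.rep_eq
      by (rule sum.reindex_bij_witness[where i = prod.swap and j = prod.swap])
         (auto simp: algebra_simps)
  qed
  show "1 * f = f"
  proof (rule mfps_eqI)
    fix A :: "'n multiset"
    have "mfps_nth (1 * f) A = (\<Sum>(B, C)\<in>{({#} :: 'n multiset, A)}. mfps_nth 1 B * mfps_nth f C)"
      unfolding times_mfps.rep_eq
      by (rule sum.mono_neutral_right)
         (use finite_mset_splits in \<open>auto simp: one_mfps.rep_eq split: if_splits\<close>)
    then show "mfps_nth (1 * f) A = mfps_nth f A"
      by (simp add: one_mfps.rep_eq)
  qed
  show "(f + g) * h = f * h + g * h"
    by (rule mfps_eqI)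
       (simp add: times_mfps.rep_eq plus_mfps.rep_eq case_prod_beta distrib_right sum.distrib)
  show "(0 :: ('a, 'n) mfps) \<noteq> 1"
    by transfer (metis zero_neq_one)
qed (transfer; simp add: algebra_simps fun_eq_iff)+

end

lift_definition mfps_const :: "'a::zero \<Rightarrow> ('a, 'n) mfps"
  is "\<lambda>c A. if A = {#} then c else 0" .

lift_definition mfps_X :: "'n \<Rightarrow> ('a::zero_neq_one, 'n) mfps"
  is "\<lambda>i A. if A = {#i#} then 1 else 0" .

text \<open>Partial derivative with respect to the \<open>i\<close>-th variable.\<close>

lift_definition mfps_deriv :: "'n \<Rightarrow> ('a::semiring_1, 'n) mfps \<Rightarrow> ('a, 'n) mfps"
  is "\<lambda>i f A. of_nat (Suc (count A i)) * f (add_mset i A)" .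


section \<open>Local rings\<close>

definition local_ring :: "('a, 'b) ring_scheme \<Rightarrow> bool" where
  "local_ring R \<longleftrightarrow> cring R \<and> (\<exists>!M. maximalideal M R)"

definition max_ideal :: "('a, 'b) ring_scheme \<Rightarrow> 'a set" where
  "max_ideal R = (THE M. maximalideal M R)"

definition krull_dim :: "('a, 'b) ring_scheme \<Rightarrow> enat" where
  "krull_dim R = Sup {enat k | k. \<exists>p. (\<forall>i\<le>k. primeideal (p i) R) \<and> (\<forall>i<k. p i \<subset> p (Suc i))}"

text \<open>
  In a Noetherian local ring every generating set of the maximal ideal has at least
  \<open>krull_dim R\<close> elements.
\<close>

definition regular_local_ring :: "('a, 'b) ring_scheme \<Rightarrow> bool" where
  "regular_local_ring R \<longleftrightarrow> noetherian_ring R \<and> local_ring R \<and>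
     (\<exists>S \<subseteq> carrier R. finite S \<and> enat (card S) = krull_dim R \<and> genideal R S = max_ideal R)"

text \<open>
  Bijectivity of the canonical map from \<open>R\<close> to the inverse limit of the rings \<open>R / I\<^sup>k\<close>,
  with elements of the limit given by representatives: existence of \<open>y\<close> is completeness and
  uniqueness is separatedness.  Powers of ideals are taken in the monoid \<open>ideals_set R\<close>.
\<close>

definition adically_complete :: "('a, 'b) ring_scheme \<Rightarrow> 'a set \<Rightarrow> bool" where
  "adically_complete R I \<longleftrightarrow>
     (\<forall>x :: nat \<Rightarrow> 'a.
        (\<forall>k. x k \<in> carrier R \<and> x (Suc k) \<ominus>\<^bsub>R\<^esub> x k \<in> I [^]\<^bsub>ideals_set R\<^esub> k) \<longrightarrow>
        (\<exists>!y. y \<in> carrier R \<and> (\<forall>k. y \<ominus>\<^bsub>R\<^esub> x k \<in> I [^]\<^bsub>ideals_set R\<^esub> k)))"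


section \<open>Modules\<close>

text \<open>
  The record type of modules extends the one of rings; the fields \<open>mult\<close> and \<open>one\<close> play no
  role for modules.
\<close>

definition ideal_module :: "('a, 'b) ring_scheme \<Rightarrow> 'a set \<Rightarrow> ('a, 'a) module" where
  "ideal_module R I =
     \<lparr>carrier = I, monoid.mult = undefined, one = undefined, zero = \<zero>\<^bsub>R\<^esub>, add = add R, module.smult = monoid.mult R\<rparr>"

definition free_module :: "('a::comm_ring_1, 'a ^ 'n) module" where
  "free_module =
     \<lparr>carrier = UNIV, monoid.mult = undefined, one = undefined, zero = 0, add = (+), module.smult = (*s)\<rparr>"

definition quotient_module :: "('a, 'c) module \<Rightarrow> 'c set \<Rightarrow> ('a, 'c set) module" where
  "quotient_module M N =
     \<lparr>carrier = a_rcosets\<^bsub>M\<^esub> N, monoid.mult = undefined, one = undefined, zero = N, add = set_add M,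
      module.smult = (\<lambda>r A. \<Union>x\<in>A. N +>\<^bsub>M\<^esub> (r \<odot>\<^bsub>M\<^esub> x))\<rparr>"

definition module_Hom ::
    "('a, 'b) ring_scheme \<Rightarrow> ('a, 'c) module \<Rightarrow> ('a, 'd) module \<Rightarrow> ('c \<Rightarrow> 'd) set" where
  "module_Hom R M N = {\<alpha> \<in> carrier M \<rightarrow> carrier N.
     (\<forall>x\<in>carrier M. \<forall>y\<in>carrier M. \<alpha> (x \<oplus>\<^bsub>M\<^esub> y) = \<alpha> x \<oplus>\<^bsub>N\<^esub> \<alpha> y) \<and>
     (\<forall>r\<in>carrier R. \<forall>x\<in>carrier M. \<alpha> (r \<odot>\<^bsub>M\<^esub> x) = r \<odot>\<^bsub>N\<^esub> \<alpha> x)}"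

text \<open>The sum of a family of ideals is the ideal generated by their union.\<close>

definition trace_ideal :: "('a, 'b) ring_scheme \<Rightarrow> ('a, 'c) module \<Rightarrow> 'a set" where
  "trace_ideal R M =
     genideal R (\<Union>\<alpha>\<in>module_Hom R M (ideal_module R (carrier R)). \<alpha> ` carrier M)"


section \<open>Differentials and quasihomogeneity\<close>

text \<open>
  Here \<open>\<phi>\<close> is the projection of the power series ring onto its quotient by the ideal generated
  by the components of \<open>f\<close>.  Rows of the Jacobian matrix are indexed by the variables and columns
  by the generators, so that it maps \<open>'r ^ 'm\<close> to \<open>'r ^ 'n\<close>.
\<close>

definition jacobian ::
    "(('k::comm_ring_1, 'n::finite) mfps \<Rightarrow> 'r::comm_ring_1) \<Rightarrow> ('k, 'n) mfps ^ 'm::finite \<Rightarrow> 'r ^ 'm ^ 'n" where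
  "jacobian \<phi> f = (\<chi> i j. \<phi> (mfps_deriv i (f $ j)))"

definition differentials ::
    "(('k::comm_ring_1, 'n::finite) mfps \<Rightarrow> 'r::comm_ring_1) \<Rightarrow> ('k, 'n) mfps ^ 'm::finite
      \<Rightarrow> ('r, ('r ^ 'n) set) module" where
  "differentials \<phi> f = quotient_module free_module (range ((*v) (jacobian \<phi> f)))"

definition quasihomogeneous ::
    "(('k::comm_ring_1, 'n::finite) mfps \<Rightarrow> 'r::comm_ring_1) \<Rightarrow> ('k, 'n) mfps ^ 'm::finite \<Rightarrow> bool" where
  "quasihomogeneous \<phi> f \<longleftrightarrow>
     (let R = (ring_of_type_algebra :: 'r ring) in
        \<exists>\<alpha>\<in>module_Hom R (differentials \<phi> f) (ideal_module R (max_ideal R)).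
          \<alpha> ` carrier (differentials \<phi> f) = max_ideal R)"


section \<open>Integral closure and order valuation\<close>

definition integral_closure :: "'r::idom itself \<Rightarrow> 'r fract set" where
  "integral_closure _ =
     {x. \<exists>p. lead_coeff p = 1 \<and> (\<forall>i. coeff p i \<in> range to_fract) \<and> poly p x = 0}"

definition integral_closure_ring :: "'r::idom itself \<Rightarrow> 'r fract ring" where
  "integral_closure_ring T = ring_of_type_algebra\<lparr>carrier := integral_closure T\<rparr>"

definition fps_order :: "'a::zero fps \<Rightarrow> enat" where
  "fps_order p = (if p = 0 then \<infinity> else enat (subdegree p))"

text \<open>
  The function \<open>\<psi>\<close> identifies the integral closure with a power series ring.  The infimum of a
  nonempty set of type \<^typ>\<open>enat\<close> is its minimum.
\<close>

definition ideal_order :: "('r::idom fract \<Rightarrow> 'k::zero fps) \<Rightarrow> 'r set \<Rightarrow> enat" where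
  "ideal_order \<psi> J = (INF y\<in>J. fps_order (\<psi> (to_fract y)))"

end

theory Submission
  imports Defs
begin

text \<open>
  A homomorphism from the module of differentials to \<open>R\<close> is a derivation \<open>D\<close> of \<open>R\<close> over \<open>k\<close>, and its
  image is the ideal generated by the values of \<open>D\<close>.  Since \<open>R\<close> contains \<open>t\<^sup>n k[[t]]\<close> for some \<open>n\<close>,
  a derivation \<open>D\<close> is a multiple \<open>g \<cdot> d/dt\<close>, hence shifts all positive values by the constant \<open>v(g) - 1\<close>.

  If \<open>D\<close> takes a unit as value, then the shift is \<open>-e\<close> with \<open>e\<close> the least positive value, so every
  value is a multiple of \<open>e\<close>; thus \<open>e = 1\<close> and \<open>R = k[[t]]\<close> is regular.  Hence the trace ideal is
  contained in \<open>m\<close>, and it equals \<open>m\<close> if \<open>R\<close> is quasihomogeneous.  Conversely, if the trace ideal has order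
  \<open>v(m)\<close>, then this order is attained by a value of some \<open>D\<close>, which forces the shift to be \<open>0\<close>.  As the
  characteristic is \<open>0\<close>, such a \<open>D\<close> reproduces leading terms up to nonzero scalars, and successive
  approximation shows that its values generate \<open>m\<close>.
\<close>

section \<open>Rings and ideals given by types\<close>

lemma ring_of_type_algebra_simps [simp]:
  "carrier (ring_of_type_algebra :: 'a::comm_ring_1 ring) = UNIV"
  "x \<otimes>\<^bsub>ring_of_type_algebra\<^esub> y = x * y"
  "x \<oplus>\<^bsub>ring_of_type_algebra\<^esub> y = x + y"
  "\<one>\<^bsub>ring_of_type_algebra\<^esub> = (1::'a)"
  "\<zero>\<^bsub>ring_of_type_algebra\<^esub> = (0::'a)"
  by (simp_all add: ring_of_type_algebra_def)

lemma a_minus_ring_of_type_algebra [simp]: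
  "x \<ominus>\<^bsub>ring_of_type_algebra\<^esub> y = x - (y :: 'a::comm_ring_1)"
proof -
  interpret ring "ring_of_type_algebra :: 'a ring" by (rule ring_from_type_algebra)
  have "\<ominus>\<^bsub>ring_of_type_algebra\<^esub> y = - y"
    by (rule minus_equality) simp_all
  then show ?thesis by (simp add: minus_eq)
qed

lemma ideal_ring_of_type_algebra_iff:
  fixes I :: "'a::comm_ring_1 set"
  shows "ideal I ring_of_type_algebra \<longleftrightarrow>
    0 \<in> I \<and> (\<forall>a\<in>I. \<forall>b\<in>I. a + b \<in> I) \<and> (\<forall>a\<in>I. \<forall>r. r * a \<in> I)"
proof
  assume "ideal I ring_of_type_algebra"
  then interpret ideal I "ring_of_type_algebra :: 'a ring" .
  show "0 \<in> I \<and> (\<forall>a\<in>I. \<forall>b\<in>I. a + b \<in> I) \<and> (\<forall>a\<in>I. \<forall>r. r * a \<in> I)"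
    using additive_subgroup.zero_closed[OF is_additive_subgroup]
      additive_subgroup.a_closed[OF is_additive_subgroup] I_l_closed by simp
next
  assume I: "0 \<in> I \<and> (\<forall>a\<in>I. \<forall>b\<in>I. a + b \<in> I) \<and> (\<forall>a\<in>I. \<forall>r. r * a \<in> I)"
  interpret ring "ring_of_type_algebra :: 'a ring" by (rule ring_from_type_algebra)
  have uminus: "\<ominus>\<^bsub>ring_of_type_algebra\<^esub> a = - a" for a :: 'a
    by (rule minus_equality) simp_all
  show "ideal I ring_of_type_algebra"
  proof (rule idealI)
    show "subgroup I (add_monoid (ring_of_type_algebra :: 'a ring))"
    proof (rule add.subgroupI)
      fix a assume "a \<in> I"
      then have "-1 * a \<in> I" using I by blast
      then show "\<ominus>\<^bsub>ring_of_type_algebra\<^esub> a \<in> I" by (simp add: uminus)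
    qed (use I in auto)
    show "x \<otimes>\<^bsub>ring_of_type_algebra\<^esub> a \<in> I" "a \<otimes>\<^bsub>ring_of_type_algebra\<^esub> x \<in> I" if "a \<in> I" for a x
      using I that by (auto simp: mult.commute)
  qed (rule ring_axioms)
qed

lemma genideal_subset_iff:
  fixes S :: "'a::comm_ring_1 set"
  assumes "ideal I ring_of_type_algebra"
  shows "genideal ring_of_type_algebra S \<subseteq> I \<longleftrightarrow> S \<subseteq> I"
  using assms by (auto simp: genideal_def)

lemma genideal_superset: "S \<subseteq> genideal R S"
  by (auto simp: genideal_def)

lemma ideal_genideal_ring_of_type_algebra:
  "ideal (genideal ring_of_type_algebra S) (ring_of_type_algebra :: 'a::comm_ring_1 ring)"
  by (rule ring.genideal_ideal) (auto intro: ring_from_type_algebra)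

text \<open>Zorn's lemma applies because in a Noetherian ring the union of a nonempty chain of
  ideals is itself a member of the chain.\<close>

lemma (in noetherian_ring) exists_maximalideal:
  assumes I: "ideal I R" "I \<noteq> carrier R"
  shows "\<exists>M. maximalideal M R \<and> I \<subseteq> M"
proof -
  define A where "A = {J. ideal J R \<and> I \<subseteq> J \<and> J \<noteq> carrier R}"
  have "\<exists>M\<in>A. \<forall>J\<in>A. M \<subseteq> J \<longrightarrow> J = M"
  proof (rule subset_Zorn_nonempty)
    show "A \<noteq> {}" using I by (auto simp: A_def)
    fix C assume C: "C \<noteq> {}" "subset.chain A C"
    then have "subset.chain {J. ideal J R} C"
      by (auto simp: subset_chain_def A_def)
    from ideal_chain_is_trivial[OF C(1) this] C(2) show "\<Union>C \<in> A"
      by (auto simp: subset_chain_def)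
  qed
  then obtain M where M: "M \<in> A" and max: "\<And>J. J \<in> A \<Longrightarrow> M \<subseteq> J \<Longrightarrow> J = M" by blast
  have "maximalideal M R"
  proof (rule maximalidealI)
    show "ideal M R" "carrier R \<noteq> M" using M by (auto simp: A_def)
    fix J assume "ideal J R" "M \<subseteq> J" "J \<subseteq> carrier R"
    then show "J = M \<or> J = carrier R"
      using max[of J] M by (auto simp: A_def)
  qed
  then show ?thesis using M by (auto simp: A_def)
qed

lemma maximalideal_max_ideal:
  assumes "local_ring R"
  shows "maximalideal (max_ideal R) R"
  using assms unfolding local_ring_def max_ideal_def by (metis theI')

lemma dvd_1_if_not_in_max_ideal:
  fixes y :: "'r::comm_ring_1"
  defines "R \<equiv> ring_of_type_algebra :: 'r ring"
  assumes noeth: "noetherian_ring R" and loc: "local_ring R" and y: "y \<notin> max_ideal R"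
  shows "y dvd 1"
proof (rule ccontr)
  assume not_unit: "\<not> y dvd 1"
  have "ideal (range ((*) y)) R"
    unfolding R_def ideal_ring_of_type_algebra_iff
    using rangeI[of "(*) y" 0] by (auto simp: mult.left_commute[of _ y] simp flip: distrib_left)
  moreover have "1 \<notin> range ((*) y)"
    using not_unit by (auto simp: dvd_def)
  then have "range ((*) y) \<noteq> carrier R"
    by (auto simp: R_def)
  ultimately obtain M where M: "maximalideal M R" "range ((*) y) \<subseteq> M"
    using noetherian_ring.exists_maximalideal[OF noeth] by blast
  then have "M = max_ideal R"
    using loc maximalideal_max_ideal[OF loc] unfolding local_ring_def by blast
  with M(2) have "y * 1 \<in> max_ideal R" by blast
  with y show False by simp
qed

text \<open>This controls the terms of a series in \<open>x\<close> with coefficients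
  \<open>w\<close>: its partial sums are Cauchy in the sense of
  \<open>adically_complete\<close>.\<close>

lemma power_mult_in_ideal_power:
  fixes x :: "'a::comm_ring_1"
  assumes "x \<in> I"
  shows "x ^ k * w \<in> I [^]\<^bsub>ideals_set (ring_of_type_algebra :: 'a ring)\<^esub> k"
proof (induction k arbitrary: w)
  case (Suc k)
  have "(x ^ k * w) \<otimes>\<^bsub>ring_of_type_algebra\<^esub> x
      \<in> ideal_prod ring_of_type_algebra (I [^]\<^bsub>ideals_set (ring_of_type_algebra :: 'a ring)\<^esub> k) I"
    by (rule ideal_prod.prod[OF Suc.IH assms])
  then show ?case by (simp add: ideals_set_def mult.commute mult.left_commute)
qed (simp add: ideals_set_def)

text \<open>This turns adic convergence in the source into \<open>t\<close>-adic convergence in the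
  target.\<close>

lemma dvd_if_in_ideal_power:
  fixes \<sigma> :: "'a::comm_ring_1 \<Rightarrow> 'b::comm_ring_1"
  assumes "\<And>a b. \<sigma> (a + b) = \<sigma> a + \<sigma> b" "\<And>a b. \<sigma> (a * b) = \<sigma> a * \<sigma> b"
    and "\<And>a. a \<in> I \<Longrightarrow> t dvd \<sigma> a"
    and "y \<in> I [^]\<^bsub>ideals_set (ring_of_type_algebra :: 'a ring)\<^esub> k"
  shows "t ^ k dvd \<sigma> y"
  using assms(4)
proof (induction k arbitrary: y)
  case (Suc k)
  then have "y \<in> ideal_prod ring_of_type_algebra (I [^]\<^bsub>ideals_set (ring_of_type_algebra :: 'a ring)\<^esub> k) I"
    by (simp add: ideals_set_def)
  then show ?case
  proof (induction y rule: ideal_prod.induct)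
    case (prod i j)
    then have "t ^ k * t dvd \<sigma> i * \<sigma> j" by (intro mult_dvd_mono Suc.IH assms(3))
    then show ?case by (simp add: assms mult.commute)
  qed (simp add: assms)
qed simp

section \<open>Differentials\<close>

lemma mfps_deriv_add: "mfps_deriv i (p + q) = mfps_deriv i p + mfps_deriv i q"
  by (rule mfps_eqI) (simp add: mfps_deriv.rep_eq plus_mfps.rep_eq algebra_simps)

lemma mfps_deriv_const: "mfps_deriv i (mfps_const c) = 0"
  by (rule mfps_eqI) (simp add: mfps_deriv.rep_eq mfps_const.rep_eq zero_mfps.rep_eq)

lemma mfps_deriv_X: "mfps_deriv i (mfps_X j) = (if i = j then 1 else 0)"
  by (rule mfps_eqI) (auto simp: mfps_deriv.rep_eq mfps_X.rep_eq zero_mfps.rep_eq one_mfps.rep_eq)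

text \<open>The index shift behind the product rule: splittings with \<open>i\<close> not in
  \<open>B\<close> contribute \<open>0\<close>, and in the others one copy of \<open>i\<close> is
  removed from \<open>B\<close>.\<close>

lemma sum_count_mset_splits:
  fixes F :: "'n multiset \<Rightarrow> 'n multiset \<Rightarrow> 'a::comm_ring_1"
  shows "(\<Sum>(B, C) | B + C = add_mset i A. of_nat (count B i) * F B C) =
    (\<Sum>(B, C) | B + C = A. of_nat (Suc (count B i)) * F (add_mset i B) C)"
proof -
  have "(\<Sum>(B, C) | B + C = add_mset i A. of_nat (count B i) * F B C) =
      (\<Sum>(B, C) | B + C = add_mset i A \<and> i \<in># B. of_nat (count B i) * F B C)"
    by (rule sum.mono_neutral_right)
       (use finite_mset_splits in \<open>auto simp flip: count_greater_zero_iff intro!: gr0I\<close>)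
  also have "\<dots> = (\<Sum>(B, C) | B + C = A. of_nat (Suc (count B i)) * F (add_mset i B) C)"
    by (rule sum.reindex_bij_witness
          [where i = "\<lambda>(B, C). (add_mset i B, C)" and j = "\<lambda>(B, C). (B - {#i#}, C)"])
       (auto dest!: multi_member_split)
  finally show ?thesis .
qed

text \<open>The exponent of \<open>i\<close> in a product of monomials is the sum of its exponents
  in the factors, so the coefficient sum splits into one sum per factor.\<close>

lemma mfps_deriv_mult:
  fixes p q :: "('a::comm_ring_1, 'n) mfps"
  shows "mfps_deriv i (p * q) = p * mfps_deriv i q + q * mfps_deriv i p"
proof (rule mfps_eqI)
  fix A :: "'n multiset"
  let ?p = "mfps_nth p" and ?q = "mfps_nth q"
  have swap: "(\<Sum>(B, C) | B + C = A. G B C) = (\<Sum>(B, C) | B + C = A. G C B)"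
    for A :: "'n multiset" and G :: "'n multiset \<Rightarrow> 'n multiset \<Rightarrow> 'a"
    by (rule sum.reindex_bij_witness[where i = prod.swap and j = prod.swap])
       (auto simp: add.commute)
  have "mfps_nth (mfps_deriv i (p * q)) A =
      (\<Sum>(B, C) | B + C = add_mset i A. of_nat (Suc (count A i)) * (?p B * ?q C))"
    by (simp add: mfps_deriv.rep_eq times_mfps.rep_eq sum_distrib_left case_prod_unfold del: of_nat_Suc)
  also have "\<dots> = (\<Sum>(B, C) | B + C = add_mset i A.
      of_nat (count B i) * (?p B * ?q C) + of_nat (count C i) * (?p B * ?q C))"
  proof (rule sum.cong, safe)
    fix B C assume "B + C = add_mset i A"
    then have "count (B + C) i = count (add_mset i A) i" by simp
    then have "Suc (count A i) = count B i + count C i" by simp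
    then show "of_nat (Suc (count A i)) * (?p B * ?q C) =
        of_nat (count B i) * (?p B * ?q C) + of_nat (count C i) * (?p B * ?q C)"
      by (simp only: of_nat_add distrib_right)
  qed
  also have "\<dots> = (\<Sum>(B, C) | B + C = add_mset i A. of_nat (count B i) * (?p B * ?q C)) +
      (\<Sum>(B, C) | B + C = add_mset i A. of_nat (count C i) * (?p B * ?q C))"
    by (simp add: sum.distrib case_prod_beta)
  also have "(\<Sum>(B, C) | B + C = add_mset i A. of_nat (count C i) * (?p B * ?q C)) =
      (\<Sum>(B, C) | B + C = add_mset i A. of_nat (count B i) * (?p C * ?q B))"
    by (rule swap)
  also have "\<dots> = (\<Sum>(B, C) | B + C = A. of_nat (Suc (count B i)) * (?p C * ?q (add_mset i B)))"
    by (rule sum_count_mset_splits)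
  also have "\<dots> = (\<Sum>(B, C) | B + C = A. of_nat (Suc (count C i)) * (?p B * ?q (add_mset i C)))"
    by (rule swap)
  also have "(\<Sum>(B, C) | B + C = add_mset i A. of_nat (count B i) * (?p B * ?q C)) =
      (\<Sum>(B, C) | B + C = A. of_nat (Suc (count B i)) * (?p (add_mset i B) * ?q C))"
    by (rule sum_count_mset_splits)
  also have "\<dots> = (\<Sum>(B, C) | B + C = A. of_nat (Suc (count C i)) * (?p (add_mset i C) * ?q B))"
    by (rule swap)
  finally show "mfps_nth (mfps_deriv i (p * q)) A = mfps_nth (p * mfps_deriv i q + q * mfps_deriv i p) A"
    by (simp add: plus_mfps.rep_eq times_mfps.rep_eq mfps_deriv.rep_eq case_prod_unfold mult_ac del: of_nat_Suc)
qed

section \<open>Quotients of a free module, computed with cosets\<close>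

definition coset :: "('a::comm_ring_1 ^ 'n) set \<Rightarrow> 'a ^ 'n \<Rightarrow> ('a ^ 'n) set" where
  "coset N v = {u. u - v \<in> N}"

locale column_space =
  fixes N :: "('a::comm_ring_1 ^ 'n::finite) set"
  assumes zero_mem: "0 \<in> N"
    and add_mem: "u \<in> N \<Longrightarrow> v \<in> N \<Longrightarrow> u + v \<in> N"
    and smult_mem: "v \<in> N \<Longrightarrow> r *s v \<in> N"
begin

lemma a_r_coset_eq: "N +>\<^bsub>free_module\<^esub> v = coset N v"
proof -
  have "N +>\<^bsub>free_module\<^esub> v = (\<lambda>n. n + v) ` N"
    by (auto simp: a_r_coset_def r_coset_def free_module_def)
  also have "\<dots> = coset N v"
    by (auto simp: coset_def image_iff) (metis diff_add_cancel)
  finally show ?thesis .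
qed

lemma coset_eq_iff: "coset N u = coset N v \<longleftrightarrow> u - v \<in> N"
proof
  assume "coset N u = coset N v"
  moreover have "u \<in> coset N u" using zero_mem by (simp add: coset_def)
  ultimately show "u - v \<in> N" by (simp add: coset_def)
next
  assume uv: "u - v \<in> N"
  then have vu: "v - u \<in> N" using smult_mem[of "u - v" "-1"] by (simp add: vector_smult_lneg)
  show "coset N u = coset N v"
    unfolding coset_def using add_mem[OF _ uv] add_mem[OF _ vu] by force
qed

lemma carrier_quotient_module: "carrier (quotient_module free_module N) = range (coset N)"
  by (simp add: quotient_module_def A_RCOSETS_def' a_r_coset_eq) (auto simp: free_module_def)

lemma add_quotient_module:
  "coset N u \<oplus>\<^bsub>quotient_module free_module N\<^esub> coset N v = coset N (u + v)"
proof -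
  have "coset N u \<oplus>\<^bsub>quotient_module free_module N\<^esub> coset N v = {x + y | x y. x \<in> coset N u \<and> y \<in> coset N v}"
    by (auto simp: quotient_module_def set_add_def set_mult_def free_module_def)
  also have "\<dots> = coset N (u + v)"
  proof (intro equalityI subsetI)
    fix w assume "w \<in> {x + y | x y. x \<in> coset N u \<and> y \<in> coset N v}"
    then obtain x y where "w = x + y" "x - u \<in> N" "y - v \<in> N" by (auto simp: coset_def)
    moreover from add_mem[OF this(2,3)] have "x + y - (u + v) \<in> N" by (simp add: algebra_simps)
    ultimately show "w \<in> coset N (u + v)" by (simp add: coset_def)
  next
    fix w assume "w \<in> coset N (u + v)"
    then have "w - v \<in> coset N u" "v \<in> coset N v"
      using zero_mem by (simp_all add: coset_def algebra_simps)
    moreover have "w = (w - v) + v" by simp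
    ultimately show "w \<in> {x + y | x y. x \<in> coset N u \<and> y \<in> coset N v}" by blast
  qed
  finally show ?thesis .
qed

lemma smult_quotient_module:
  "r \<odot>\<^bsub>quotient_module free_module N\<^esub> coset N v = coset N (r *s v)"
proof -
  have "coset N (r *s u) = coset N (r *s v)" if "u \<in> coset N v" for u
    unfolding coset_eq_iff using smult_mem[of "u - v" r] that
    by (simp add: coset_def vector_ssub_ldistrib)
  moreover have "v \<in> coset N v" using zero_mem by (simp add: coset_def)
  ultimately have "(\<Union>u\<in>coset N v. coset N (r *s u)) = coset N (r *s v)" by blast
  then show ?thesis
    by (simp add: quotient_module_def a_r_coset_eq) (simp add: free_module_def)
qed

end

lemma column_space_matrix:
  fixes A :: "'a::comm_ring_1 ^ 'm::finite ^ 'n::finite"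
  shows "column_space (range ((*v) A))"
proof
  show "0 \<in> range ((*v) A)" using rangeI[of "(*v) A" 0] by simp
  show "u + v \<in> range ((*v) A)" if "u \<in> range ((*v) A)" "v \<in> range ((*v) A)" for u v
    using that by (auto simp flip: matrix_vector_right_distrib)
  show "r *s v \<in> range ((*v) A)" if "v \<in> range ((*v) A)" for r v
  proof -
    obtain w where "v = A *v w" using \<open>v \<in> _\<close> by blast
    then have "r *s v = A *v (r *s w)"
      by (simp add: matrix_vector_mult_def vec_eq_iff sum_distrib_left mult_ac)
    then show ?thesis by blast
  qed
qed

text \<open>\<open>D\<close> is \<open>\<alpha>\<close> composed with the universal derivation,
  which sends \<open>\<phi> p\<close> to the class of the gradient of \<open>p\<close>. The
  gradients of the variables are the basis vectors, so the values of \<open>D\<close> generate the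
  image of \<open>\<alpha>\<close>.\<close>

lemma derivation_of_module_Hom:
  fixes \<phi> :: "('k::comm_ring_1, 'n::finite) mfps \<Rightarrow> 'r::comm_ring_1" and f :: "('k, 'n) mfps ^ 'm::finite"
  assumes \<phi>: "\<phi> \<in> ring_hom ring_of_type_algebra ring_of_type_algebra" "surj \<phi>"
    and kernel: "a_kernel ring_of_type_algebra ring_of_type_algebra \<phi> = genideal ring_of_type_algebra (range (($) f))"
    and \<alpha>: "\<alpha> \<in> module_Hom ring_of_type_algebra (differentials \<phi> f) (ideal_module ring_of_type_algebra I)"
  obtains D where "\<And>a b. D (a + b) = D a + D b" "\<And>a b. D (a * b) = a * D b + b * D a"
    "\<And>c. D (\<phi> (mfps_const c)) = 0"
    "\<alpha> ` carrier (differentials \<phi> f) = genideal ring_of_type_algebra (range D)"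
proof -
  have \<phi>_add: "\<phi> (p + q) = \<phi> p + \<phi> q" and \<phi>_mult: "\<phi> (p * q) = \<phi> p * \<phi> q" and \<phi>_1: "\<phi> 1 = 1" for p q
    using \<phi>(1) by (auto simp: ring_hom_def)
  have \<phi>_0: "\<phi> 0 = 0" using \<phi>_add[of 0 0] by simp
  have \<phi>_diff: "\<phi> (p - q) = \<phi> p - \<phi> q" for p q
    by (metis \<phi>_add add_diff_cancel_right' diff_add_cancel)
  define N where "N = range ((*v) (jacobian \<phi> f))"
  interpret column_space N unfolding N_def by (rule column_space_matrix)
  define \<beta> where "\<beta> v = \<alpha> (coset N v)" for v
  have \<Omega>: "differentials \<phi> f = quotient_module free_module N"
    by (simp add: differentials_def N_def)
  have \<beta>_add: "\<beta> (u + v) = \<beta> u + \<beta> v" and \<beta>_smult: "\<beta> (r *s v) = r * \<beta> v" for u v r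
    using \<alpha> by (auto simp: module_Hom_def \<Omega> carrier_quotient_module ideal_module_def \<beta>_def
        simp flip: add_quotient_module smult_quotient_module)
  have \<beta>_cong: "\<beta> u = \<beta> v" if "u - v \<in> N" for u v
    using that by (simp add: \<beta>_def flip: coset_eq_iff)
  have \<beta>_0: "\<beta> 0 = 0" using \<beta>_add[of 0 0] by simp
  have \<beta>_image: "\<alpha> ` carrier (differentials \<phi> f) = range \<beta>"
    by (auto simp: \<Omega> carrier_quotient_module \<beta>_def)
  have \<beta>_sum: "\<beta> (\<Sum>i\<in>S. g i) = (\<Sum>i\<in>S. \<beta> (g i))" if "finite S" for S and g :: "'n \<Rightarrow> _"
    using that by induction (simp_all add: \<beta>_0 \<beta>_add)
  define d where "d p = (\<chi> i. \<phi> (mfps_deriv i p))" for p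
  have d_add: "d (p + q) = d p + d q" for p q
    by (simp add: d_def vec_eq_iff mfps_deriv_add \<phi>_add)
  have d_diff: "d (p - q) = d p - d q" for p q
    by (metis d_add add_diff_cancel_right' diff_add_cancel)
  have d_mult: "d (p * q) = \<phi> p *s d q + \<phi> q *s d p" for p q
    by (simp add: d_def vec_eq_iff mfps_deriv_mult \<phi>_add \<phi>_mult)
  have d_const: "d (mfps_const c) = 0" for c
    by (simp add: d_def vec_eq_iff mfps_deriv_const \<phi>_0)
  have d_X: "d (mfps_X i) = axis i 1" for i
    by (auto simp: d_def axis_def vec_eq_iff mfps_deriv_X \<phi>_0 \<phi>_1)
  have kernel': "{p. \<phi> p = 0} = genideal ring_of_type_algebra (range (($) f))"
    unfolding kernel[symmetric] by (simp add: a_kernel_def' )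
  have d_kernel: "d p \<in> N" if "\<phi> p = 0" for p
  proof -
    \<comment> \<open>The condition \<open>\<phi> p = 0\<close> is carried along because it kills
      the second term of \<open>d (r * p) = \<phi> r *s d p + \<phi> p *s d r\<close>. The
      generators qualify since the gradient of \<open>f $ j\<close> is column \<open>j\<close> of
      the Jacobian matrix.\<close>
    have "ideal {p. \<phi> p = 0 \<and> d p \<in> N} ring_of_type_algebra"
      unfolding ideal_ring_of_type_algebra_iff
      using zero_mem add_mem smult_mem d_diff[of 0 0]
      by (auto simp: \<phi>_0 \<phi>_add \<phi>_mult d_add d_mult)
    moreover have "range (($) f) \<subseteq> {p. \<phi> p = 0 \<and> d p \<in> N}"
    proof clarify
      fix j
      have "d (f $ j) = jacobian \<phi> f *v axis j 1"
        by (simp add: d_def jacobian_def matrix_vector_mult_def axis_def vec_eq_iff if_distrib cong: if_cong)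
      moreover have "f $ j \<in> {p. \<phi> p = 0}"
        unfolding kernel' by (rule subsetD[OF genideal_superset]) simp
      ultimately show "\<phi> (f $ j) = 0 \<and> d (f $ j) \<in> N" by (auto simp: N_def)
    qed
    ultimately have "{p. \<phi> p = 0} \<subseteq> {p. \<phi> p = 0 \<and> d p \<in> N}"
      unfolding kernel' by (subst genideal_subset_iff)
    with that show ?thesis by blast
  qed
  \<comment> \<open>The choice of preimage is harmless: two preimages differ by an element of the
    kernel, whose gradient lies in \<open>N\<close>.\<close>
  define D where "D a = \<beta> (d (inv_into UNIV \<phi> a))" for a
  have D: "D (\<phi> p) = \<beta> (d p)" for p
  proof -
    have "\<phi> (inv_into UNIV \<phi> (\<phi> p) - p) = 0"
      unfolding \<phi>_diff surj_f_inv_f[OF \<phi>(2)] by (rule diff_self)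
    then have "d (inv_into UNIV \<phi> (\<phi> p)) - d p \<in> N"
      unfolding d_diff[symmetric] by (rule d_kernel)
    then show ?thesis
      unfolding D_def by (rule \<beta>_cong)
  qed
  show thesis
  proof
    show "D (a + b) = D a + D b" for a b
    proof -
      obtain p q where "a = \<phi> p" "b = \<phi> q" using surjD[OF \<phi>(2)] by blast
      then show ?thesis by (simp add: D d_add \<beta>_add flip: \<phi>_add)
    qed
    show "D (a * b) = a * D b + b * D a" for a b
    proof -
      obtain p q where "a = \<phi> p" "b = \<phi> q" using surjD[OF \<phi>(2)] by blast
      then show ?thesis by (simp add: D d_mult \<beta>_add \<beta>_smult flip: \<phi>_mult)
    qed
    show "D (\<phi> (mfps_const c)) = 0" for c
      by (simp add: D d_const \<beta>_0)
    show "\<alpha> ` carrier (differentials \<phi> f) = genideal ring_of_type_algebra (range D)"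
    proof
      have "ideal (range \<beta>) ring_of_type_algebra"
        unfolding ideal_ring_of_type_algebra_iff
        using rangeI[of \<beta> 0] \<beta>_0 by (auto simp flip: \<beta>_add \<beta>_smult)
      then show "genideal ring_of_type_algebra (range D) \<subseteq> \<alpha> ` carrier (differentials \<phi> f)"
        unfolding \<beta>_image by (subst genideal_subset_iff) (auto simp: D_def)
      let ?J = "genideal ring_of_type_algebra (range D)"
      have J: "0 \<in> ?J" "\<And>a b. a \<in> ?J \<Longrightarrow> b \<in> ?J \<Longrightarrow> a + b \<in> ?J" "\<And>a r. a \<in> ?J \<Longrightarrow> r * a \<in> ?J"
        using ideal_genideal_ring_of_type_algebra[of "range D"]
        unfolding ideal_ring_of_type_algebra_iff by blast+
      show "\<alpha> ` carrier (differentials \<phi> f) \<subseteq> ?J"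
        unfolding \<beta>_image
      proof clarify
        fix v
        have "\<beta> v = \<beta> (\<Sum>i\<in>UNIV. v $ i *s axis i 1)" by (simp add: basis_expansion)
        also have "\<dots> = (\<Sum>i\<in>UNIV. v $ i * D (\<phi> (mfps_X i)))"
          by (simp add: \<beta>_sum \<beta>_smult D d_X)
        also have "\<dots> \<in> ?J"
        proof -
          have "(\<Sum>i\<in>S. v $ i * D (\<phi> (mfps_X i))) \<in> ?J" if "finite S" for S
            using that
          proof induction
            case (insert i S)
            have "D (\<phi> (mfps_X i)) \<in> ?J" by (rule subsetD[OF genideal_superset]) simp
            with insert show ?case by (simp add: J)
          qed (simp add: J)
          then show ?thesis by simp
        qed
        finally show "\<beta> v \<in> ?J" .
      qed
    qed
  qed
qed

section \<open>Order and divisibility of power series in one variable\<close>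

unbundle no vec_syntax

lemma fps_X_power_dvd_iff:
  "fps_X ^ n dvd (f :: 'a::field fps) \<longleftrightarrow> (\<forall>i<n. f $ i = 0)"
proof (cases "f = 0")
  case False
  then have "fps_X ^ n dvd f \<longleftrightarrow> n \<le> subdegree f"
    by (simp add: fps_dvd_iff fps_X_power_subdegree)
  also have "\<dots> \<longleftrightarrow> (\<forall>i<n. f $ i = 0)"
    using False by (meson leI nth_less_subdegree_zero nth_subdegree_nonzero order_less_le_trans subdegree_geI)
  finally show ?thesis .
qed simp

lemma fps_X_power_dvd_subdegree:
  assumes "fps_X ^ n dvd (f :: 'a::field fps)" "f \<noteq> 0"
  shows "n \<le> subdegree f"
  using assms by (metis dvd_imp_subdegree_le fps_X_power_subdegree)

lemma fps_eq_0_if_all_X_power_dvd: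
  assumes "\<And>k. K \<le> k \<Longrightarrow> fps_X ^ k dvd (f :: 'a::field fps)"
  shows "f = 0"
proof (rule ccontr)
  assume "f \<noteq> 0"
  have "fps_X ^ (max K (Suc (subdegree f))) dvd f"
    by (intro assms) simp
  from fps_X_power_dvd_subdegree[OF this \<open>f \<noteq> 0\<close>] show False
    by simp
qed

text \<open>In characteristic \<open>0\<close> the leading coefficient stays nonzero when multiplied
  by its exponent. Positivity excludes a constant leading term and, as
  \<open>subdegree 0 = 0\<close>, also \<open>f = 0\<close>.\<close>

lemma subdegree_fps_deriv:
  fixes f :: "'a::field_char_0 fps"
  assumes "subdegree f > 0"
  shows "fps_deriv f \<noteq> 0" "subdegree (fps_deriv f) + 1 = subdegree f"
proof -
  have nz: "f \<noteq> 0" using assms by auto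
  have *: "fps_deriv f $ (subdegree f - 1) \<noteq> 0"
    using assms nz by simp
  then show "fps_deriv f \<noteq> 0" by (metis fps_zero_nth)
  have "fps_deriv f $ i = 0" if "i < subdegree f - 1" for i
  proof -
    have "f $ (i + 1) = 0" using that by (intro nth_less_subdegree_zero) simp
    then show ?thesis by (simp only: fps_deriv_nth mult_zero_right)
  qed
  with * have "subdegree (fps_deriv f) = subdegree f - 1"
    by (rule subdegreeI)
  with assms show "subdegree (fps_deriv f) + 1 = subdegree f" by simp
qed

section \<open>Subrings of a power series ring in one variable\<close>

text \<open>
  The last assumption is the convergence of the series \<open>\<Sum>\<^sub>j x\<^sup>j w\<^sub>j\<close> for \<open>x\<close> in the maximal ideal.
\<close>

locale branch =
  fixes \<sigma> :: "'r::idom \<Rightarrow> 'k::field_char_0 fps" and \<kappa> :: "'k \<Rightarrow> 'r"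
  assumes add [simp]: "\<sigma> (a + b) = \<sigma> a + \<sigma> b"
    and mult [simp]: "\<sigma> (a * b) = \<sigma> a * \<sigma> b"
    and one [simp]: "\<sigma> 1 = 1"
    and const [simp]: "\<sigma> (\<kappa> c) = fps_const c"
    and inj: "\<sigma> a = 0 \<Longrightarrow> a = 0"
    and uniformizer: "\<exists>a b. b \<noteq> 0 \<and> \<sigma> a = fps_X * \<sigma> b"
    and complete: "\<sigma> x $ 0 = 0 \<Longrightarrow> \<exists>y. \<forall>k. fps_X ^ k dvd \<sigma> y - \<sigma> (\<Sum>j<k. x ^ j * w j)"
begin

lemma zero [simp]: "\<sigma> 0 = 0"
  using add[of 0 0] by (metis add_0 add_cancel_right_left)

lemma eq_0_iff [simp]: "\<sigma> a = 0 \<longleftrightarrow> a = 0"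
  using inj by auto

lemma diff [simp]: "\<sigma> (a - b) = \<sigma> a - \<sigma> b"
  by (metis add add_diff_cancel_right' diff_add_cancel)

lemma eq_iff: "\<sigma> a = \<sigma> b \<longleftrightarrow> a = b"
  by (metis diff inj right_minus_eq)

lemma power [simp]: "\<sigma> (a ^ n) = \<sigma> a ^ n"
  by (induction n) simp_all

lemma const_0 [simp]: "\<kappa> 0 = 0"
  by (rule inj) simp

text \<open>The scalar is the quotient of the coefficients at \<open>k\<close>. This is the basic
  step of the successive approximations below.\<close>

lemma cancel_leading_term:
  assumes "fps_X ^ k dvd h" "s \<noteq> 0" "subdegree (\<sigma> s) = k"
  shows "\<exists>c. fps_X ^ Suc k dvd h - \<sigma> (\<kappa> c * s)"
proof -
  have nz: "\<sigma> s $ k \<noteq> 0"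
    using assms by auto
  have "fps_X ^ Suc k dvd h - \<sigma> (\<kappa> (h $ k / \<sigma> s $ k) * s)"
    using assms nz by (auto simp: fps_X_power_dvd_iff less_Suc_eq simp del: power_Suc)
  then show ?thesis ..
qed

text \<open>The \<open>s r\<close> have the \<open>e\<close> consecutive orders from
  \<open>n\<close> on. Cancelling one coefficient after the other raises the order of
  \<open>h\<close> to \<open>n + e\<close>, and then \<open>\<sigma> x * fps_X ^ n\<close> divides
  the remainder.\<close>

lemma division_step:
  assumes x: "x \<noteq> 0" "subdegree (\<sigma> x) = e"
    and s: "\<And>r. r < e \<Longrightarrow> s r \<noteq> 0 \<and> subdegree (\<sigma> (s r)) = n + r"
    and h: "fps_X ^ n dvd h"
  shows "\<exists>w h'. h = \<sigma> w + \<sigma> x * h' \<and> fps_X ^ n dvd h'"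
proof -
  have "\<exists>w. fps_X ^ (n + r) dvd h - \<sigma> w" if "r \<le> e" for r
    using that
  proof (induction r)
    case 0
    show ?case using h by (intro exI[of _ 0]) simp
  next
    case (Suc r)
    then obtain w where w: "fps_X ^ (n + r) dvd h - \<sigma> w" by auto
    from cancel_leading_term[OF this, of "s r"] s[of r] Suc.prems
    obtain c where "fps_X ^ Suc (n + r) dvd h - \<sigma> w - \<sigma> (\<kappa> c * s r)" by auto
    then have "fps_X ^ (n + Suc r) dvd h - \<sigma> (w + \<kappa> c * s r)"
      by (simp add: algebra_simps)
    then show ?case ..
  qed
  then obtain w where "fps_X ^ (n + e) dvd h - \<sigma> w" by blast
  moreover have "\<sigma> x * fps_X ^ n dvd fps_X ^ (n + e)"
    using x by (subst fps_dvd_iff) (auto simp: fps_X_power_subdegree)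
  ultimately have "\<sigma> x * fps_X ^ n dvd h - \<sigma> w"
    by (rule dvd_trans[rotated])
  then obtain q where "h - \<sigma> w = \<sigma> x * fps_X ^ n * q" ..
  then show ?thesis
    by (intro exI[of _ w] exI[of _ "fps_X ^ n * q"]) (simp add: algebra_simps)
qed

text \<open>Iterating \<open>division_step\<close> expands \<open>h\<close> as a series in
  \<open>x\<close> with coefficients in the ring. As \<open>x\<close> has positive order, the
  remainders tend to \<open>0\<close>, and completeness supplies the sum.\<close>

lemma range_if_X_power_dvd:
  assumes x: "x \<noteq> 0" "subdegree (\<sigma> x) = e" "e > 0"
    and s: "\<And>r. r < e \<Longrightarrow> s r \<noteq> 0 \<and> subdegree (\<sigma> (s r)) = n + r"
    and h: "fps_X ^ n dvd h"
  shows "\<exists>y. \<sigma> y = h"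
proof -
  have "\<forall>h. \<exists>w h'. fps_X ^ n dvd h \<longrightarrow> h = \<sigma> w + \<sigma> x * h' \<and> fps_X ^ n dvd h'"
    using division_step[OF x(1,2) s] by blast
  then obtain W H where WH: "\<And>h. fps_X ^ n dvd h \<Longrightarrow> h = \<sigma> (W h) + \<sigma> x * H h \<and> fps_X ^ n dvd H h"
    by metis
  define g where "g = (\<lambda>k. (H ^^ k) h)"
  define w where "w = (\<lambda>k. W (g k))"
  have g0: "g 0 = h" and gS: "g (Suc k) = H (g k)" for k
    by (simp_all add: g_def)
  have g_dvd: "fps_X ^ n dvd g k" for k
    by (induction k) (use h WH in \<open>auto simp: g0 gS\<close>)
  have g: "g k = \<sigma> (w k) + \<sigma> x * g (Suc k)" for k
    using WH[OF g_dvd[of k]] by (simp add: w_def gS)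
  have expand: "h = \<sigma> (\<Sum>j<k. x ^ j * w j) + \<sigma> x ^ k * g k" for k
  proof (induction k)
    case (Suc k)
    then show ?case
      by (subst Suc.IH, subst g[of k]) (simp add: algebra_simps)
  qed (simp add: g0)
  have "\<sigma> x $ 0 = 0" using x by auto
  from complete[OF this] obtain y
    where y: "fps_X ^ k dvd \<sigma> y - \<sigma> (\<Sum>j<k. x ^ j * w j)" for k
    by blast
  have "fps_X dvd \<sigma> x"
    using \<open>\<sigma> x $ 0 = 0\<close> fps_X_power_dvd_iff[of 1 "\<sigma> x"] by simp
  then have "fps_X ^ k dvd \<sigma> x ^ k * g k" for k
    by (simp add: dvd_power_same)
  then have "fps_X ^ k dvd (\<sigma> y - \<sigma> (\<Sum>j<k. x ^ j * w j)) - \<sigma> x ^ k * g k" for k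
    using y by (rule dvd_diff[rotated])
  then have "fps_X ^ k dvd \<sigma> y - h" for k
    by (subst expand[of k]) (simp add: algebra_simps)
  then have "\<sigma> y - h = 0"
    by (rule fps_eq_0_if_all_X_power_dvd[of 0])
  then show ?thesis by auto
qed

text \<open>
  If \<open>m\<close> and \<open>m + 1\<close> are values, then so are all integers from \<open>m\<^sup>2\<close> on.
\<close>

lemma conductor: "\<exists>n>0. \<forall>h. fps_X ^ n dvd h \<longrightarrow> h \<in> range \<sigma>"
proof -
  obtain a b where b: "b \<noteq> 0" and ab: "\<sigma> a = fps_X * \<sigma> b"
    using uniformizer by blast
  define m where "m = subdegree (\<sigma> b)"
  have a: "a \<noteq> 0" "subdegree (\<sigma> a) = Suc m"
  proof -
    have "\<sigma> a \<noteq> 0" using ab b by simp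
    then show "a \<noteq> 0" by simp
    show "subdegree (\<sigma> a) = Suc m" using b by (simp add: ab m_def)
  qed
  \<comment> \<open>Since \<open>r * (m + 1) + (m - r) * m = m * m + r\<close>, these products have
    \<open>m + 1\<close> consecutive orders, as many as division by \<open>a\<close>
    requires.\<close>
  have s: "a ^ r * b ^ (m - r) \<noteq> 0 \<and> subdegree (\<sigma> (a ^ r * b ^ (m - r))) = m * m + r"
    if "r < Suc m" for r
  proof -
    have "subdegree (\<sigma> (a ^ r * b ^ (m - r))) = r * Suc m + (m - r) * m"
      using a b by (simp add: m_def)
    also have "\<dots> = (r + (m - r)) * m + r" by (simp add: algebra_simps)
    finally show ?thesis using that a b by simp
  qed
  \<comment> \<open>The exponent is raised by one because \<open>n\<close> must be positive and
    \<open>m\<close> may be \<open>0\<close>.\<close>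
  have "h \<in> range \<sigma>" if "fps_X ^ Suc (m * m) dvd h" for h
  proof -
    have "fps_X ^ (m * m) dvd h"
      using that by (meson dvd_trans le_imp_power_dvd lessI order_less_imp_le)
    from range_if_X_power_dvd[OF a _ s this] show ?thesis by auto
  qed
  then show ?thesis by blast
qed

end

section \<open>Derivations over the constants\<close>

locale branch_derivation = branch \<sigma> \<kappa>
  for \<sigma> :: "'r::idom \<Rightarrow> 'k::field_char_0 fps" and \<kappa> +
  fixes D :: "'r \<Rightarrow> 'r"
  assumes D_add: "D (a + b) = D a + D b"
    and D_mult: "D (a * b) = a * D b + b * D a"
    and D_const: "D (\<kappa> c) = 0"
begin

lemma D_0: "D 0 = 0"
  using D_const[of 0] by simp

lemma D_diff: "D (a - b) = D a - D b"
  by (metis D_add add_diff_cancel_right' diff_add_cancel)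

text \<open>
  The difference \<open>E\<close> of the two sides is a derivation killing all powers of the uniformizer that
  lie in the conductor.  Multiplication by such powers shows that \<open>E\<close> is continuous, so it vanishes.
\<close>

lemma D_eq_multiple_of_deriv:
  assumes n: "n > 0" and cond: "\<And>h. fps_X ^ n dvd h \<Longrightarrow> h \<in> range \<sigma>"
    and \<tau>: "\<sigma> \<tau> = fps_X ^ n"
  shows "of_nat n * fps_X ^ (n - 1) * \<sigma> (D y) = \<sigma> (D \<tau>) * fps_deriv (\<sigma> y)"
proof -
  \<comment> \<open>The expected factor of the derivative is \<open>\<sigma> (D \<tau>)\<close>
    divided by \<open>n * fps_X ^ (n - 1)\<close>; \<open>E\<close> measures the failure of this
    after clearing the denominator.\<close>
  define E where "E = (\<lambda>y. of_nat n * fps_X ^ (n - 1) * \<sigma> (D y) - \<sigma> (D \<tau>) * fps_deriv (\<sigma> y))"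
  have E_diff: "E (a - b) = E a - E b" for a b
    by (simp add: E_def D_diff algebra_simps)
  have E_mult: "E (a * b) = \<sigma> a * E b + \<sigma> b * E a" for a b
    by (simp add: E_def D_mult algebra_simps)
  have E_const: "E (\<kappa> c) = 0" for c
    by (simp add: E_def D_const)
  have E_\<tau>: "E \<tau> = 0"
    by (simp add: E_def \<tau> fps_deriv_power' algebra_simps)
  have E_1: "E 1 = 0"
    using E_mult[of 1 1] by (metis add_cancel_right_left mult_1 one)
  have E_power: "E (a ^ Suc j) = of_nat (Suc j) * \<sigma> a ^ j * E a" for a j
  proof (induction j)
    case (Suc j)
    have "E (a ^ Suc (Suc j)) = \<sigma> a * E (a ^ Suc j) + \<sigma> (a ^ Suc j) * E a"
      by (metis E_mult power_Suc)
    then show ?case by (simp only: Suc.IH power) (simp add: algebra_simps)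
  qed simp
  have E_X: "E s = 0" if s: "\<sigma> s = fps_X ^ j" "n \<le> j" for s j
  proof -
    \<comment> \<open>Both sides have image \<open>fps_X ^ (n * j)\<close>. Hence
      \<open>n * \<sigma> s ^ (n - 1) * E s\<close> vanishes, and its first two factors are nonzero
      in characteristic \<open>0\<close>.\<close>
    have "s ^ n = \<tau> ^ j"
      using s by (simp add: eq_iff[symmetric] \<tau> flip: power_mult add: mult.commute)
    moreover have "E (\<tau> ^ j) = 0"
      by (cases j) (use E_1 E_\<tau> in \<open>simp_all add: E_power del: power_Suc\<close>)
    ultimately have "E (s ^ n) = 0" by simp
    moreover obtain n' where "n = Suc n'" using n by (cases n) auto
    ultimately have "of_nat (Suc n') * \<sigma> s ^ n' * E s = 0"
      by (simp add: E_power del: power_Suc of_nat_Suc)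
    then show ?thesis using s by (simp del: of_nat_Suc)
  qed
  have E_cond: "E y = 0" if y: "fps_X ^ n dvd \<sigma> y" for y
  proof -
    \<comment> \<open>Scalar multiples of preimages of powers of \<open>fps_X\<close> can be
      subtracted without changing \<open>E\<close>, which raises the order of the argument at
      will.\<close>
    have approx: "\<exists>z. E z = E y \<and> fps_X ^ (n + K) dvd \<sigma> z" for K
    proof (induction K)
      case (Suc K)
      then obtain z where z: "E z = E y" "fps_X ^ (n + K) dvd \<sigma> z" by blast
      have "fps_X ^ (n + K) \<in> range \<sigma>"
        by (intro cond) (simp add: power_add)
      then obtain s where s: "\<sigma> s = fps_X ^ (n + K)" by auto
      then have "s \<noteq> 0" by (metis fps_X_neq_zero power_not_zero zero)
      from cancel_leading_term[OF z(2) this] s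
      obtain c where c: "fps_X ^ Suc (n + K) dvd \<sigma> z - \<sigma> (\<kappa> c * s)"
        by (auto simp: fps_X_power_subdegree)
      have "E (\<kappa> c * s) = 0"
        using E_X[OF s] by (simp add: E_mult E_const)
      then have "E (z - \<kappa> c * s) = E y" using z by (simp add: E_diff)
      moreover have "fps_X ^ (n + Suc K) dvd \<sigma> (z - \<kappa> c * s)"
        using c by (simp only: diff add_Suc_right)
      ultimately show ?case by blast
    qed (use y in auto)
    \<comment> \<open>Splitting \<open>fps_X ^ K\<close> off \<open>z\<close> leaves a cofactor
      \<open>u\<close> still in the conductor, and \<open>E s = 0\<close> lets the power come out of
      \<open>E\<close>.\<close>
    have "fps_X ^ K dvd E y" if "n \<le> K" for K
    proof -
      obtain z where z: "E z = E y" "fps_X ^ (n + K) dvd \<sigma> z" using approx by blast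
      then obtain h where h: "\<sigma> z = fps_X ^ (n + K) * h" by blast
      have "fps_X ^ n * h \<in> range \<sigma>" by (intro cond) simp
      then obtain u where u: "\<sigma> u = fps_X ^ n * h" by auto
      have "fps_X ^ K \<in> range \<sigma>" using \<open>n \<le> K\<close> by (intro cond le_imp_power_dvd)
      then obtain s where s: "\<sigma> s = fps_X ^ K" by auto
      have "z = s * u"
        by (simp add: eq_iff[symmetric] h s u power_add)
      then have "E y = fps_X ^ K * E u"
        using z(1) E_X[OF s \<open>n \<le> K\<close>] by (simp add: E_mult s)
      then show ?thesis by simp
    qed
    then show ?thesis by (rule fps_eq_0_if_all_X_power_dvd)
  qed
  \<comment> \<open>Multiplication by \<open>\<tau>\<close> moves any \<open>y\<close> into the
    conductor.\<close>
  have "E (\<tau> * y) = 0" by (rule E_cond) (simp add: \<tau>)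
  then have "E y = 0" by (simp add: E_mult E_\<tau> \<tau>)
  then show ?thesis by (simp add: E_def)
qed

text \<open>Orders are compared in \<open>D_eq_multiple_of_deriv\<close>: the exponent
  \<open>n - 1\<close> and the one lost by differentiation add up to \<open>n\<close>. The shift
  \<open>g - n\<close> may be negative, hence the additive form. The first case is
  \<open>D \<tau> = 0\<close>.\<close>

lemma subdegree_D:
  obtains "\<And>y. D y = 0"
  | n g where "\<And>h. fps_X ^ n dvd h \<Longrightarrow> h \<in> range \<sigma>"
      "\<And>y. subdegree (\<sigma> y) > 0 \<Longrightarrow> D y \<noteq> 0 \<and> subdegree (\<sigma> (D y)) + n = g + subdegree (\<sigma> y)"
proof -
  obtain n where n: "n > 0" and cond: "\<And>h. fps_X ^ n dvd h \<Longrightarrow> h \<in> range \<sigma>"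
    using conductor by blast
  obtain \<tau> where \<tau>: "\<sigma> \<tau> = fps_X ^ n"
    using cond[of "fps_X ^ n"] by auto
  note eq = D_eq_multiple_of_deriv[OF n cond \<tau>]
  show thesis
  proof (cases "D \<tau> = 0")
    case True
    have "D y = 0" for y
      using eq[of y] True n by simp
    then show ?thesis by (rule that(1))
  next
    case False
    have "D y \<noteq> 0 \<and> subdegree (\<sigma> (D y)) + n = subdegree (\<sigma> (D \<tau>)) + subdegree (\<sigma> y)"
      if y: "subdegree (\<sigma> y) > 0" for y
    proof -
      have "\<sigma> (D \<tau>) * fps_deriv (\<sigma> y) \<noteq> 0"
        using False subdegree_fps_deriv[OF y] by simp
      then have nz: "D y \<noteq> 0" using eq[of y] by auto
      have "n - 1 + subdegree (\<sigma> (D y)) = subdegree (of_nat n * fps_X ^ (n - 1) * \<sigma> (D y))"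
        using nz n by (simp add: fps_X_power_subdegree)
      also have "\<dots> = subdegree (\<sigma> (D \<tau>) * fps_deriv (\<sigma> y))"
        by (simp only: eq[of y])
      also have "\<dots> = subdegree (\<sigma> (D \<tau>)) + subdegree (fps_deriv (\<sigma> y))"
        using False subdegree_fps_deriv[OF y] by simp
      finally have "subdegree (\<sigma> (D y)) + n = subdegree (\<sigma> (D \<tau>)) + subdegree (\<sigma> y)"
        using n subdegree_fps_deriv(2)[OF y] by linarith
      with nz show ?thesis by simp
    qed
    with cond show ?thesis by (rule that(2))
  qed
qed

text \<open>
  Such a derivation lowers every positive value by a fixed \<open>e\<close>, so all values are multiples of \<open>e\<close>,
  and \<open>e = 1\<close> because the conductor provides consecutive values.
\<close>

lemma surj_if_D_unit:
  assumes "\<sigma> (D y) $ 0 \<noteq> 0"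
  shows "surj \<sigma>"
proof -
  define x where "x = y - \<kappa> (\<sigma> y $ 0)"
  have Dx: "D x = D y" by (simp add: x_def D_diff D_const)
  have x0: "\<sigma> x $ 0 = 0" by (simp add: x_def)
  have "D y \<noteq> 0" using assms by auto
  then have "x \<noteq> 0" using Dx D_0 by auto
  then have x: "subdegree (\<sigma> x) > 0" using x0 by (intro gr0I) (simp add: subdegree_eq_0_iff)
  show ?thesis
  proof (rule subdegree_D)
    assume "\<And>y. D y = 0"
    then show ?thesis using \<open>D y \<noteq> 0\<close> by simp
  next
    fix n g
    assume cond: "\<And>h. fps_X ^ n dvd h \<Longrightarrow> h \<in> range \<sigma>"
      and shift: "\<And>y. subdegree (\<sigma> y) > 0 \<Longrightarrow> D y \<noteq> 0 \<and> subdegree (\<sigma> (D y)) + n = g + subdegree (\<sigma> y)"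
    define e where "e = subdegree (\<sigma> x)"
    have n: "n = g + e"
      using shift[OF x] assms Dx by (simp add: e_def)
    \<comment> \<open>\<open>D\<close> lowers a positive order by exactly \<open>e\<close>, which
      gives the induction step; order \<open>0\<close>, which includes \<open>z = 0\<close>, is
      trivially a multiple.\<close>
    have e_dvd: "e dvd subdegree (\<sigma> z)" for z
    proof (induction "subdegree (\<sigma> z)" arbitrary: z rule: less_induct)
      case less
      show ?case
      proof (cases "subdegree (\<sigma> z) > 0")
        case True
        from shift[OF True] n have "subdegree (\<sigma> z) = subdegree (\<sigma> (D z)) + e" by simp
        with less[of "D z"] x show ?thesis by (simp add: e_def)
      qed simp
    qed
    have "e dvd k" if "n \<le> k" for k
    proof -
      have "fps_X ^ k \<in> range \<sigma>" using that by (intro cond le_imp_power_dvd)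
      then obtain z where "\<sigma> z = fps_X ^ k" by auto
      with e_dvd[of z] show ?thesis by (simp add: fps_X_power_subdegree)
    qed
    from dvd_diff_nat[OF this[of "n + 1"] this[of n]] have "e dvd 1" by simp
    then have "e = 1" by simp
    \<comment> \<open>Now \<open>x\<close> has order \<open>1\<close>, so division by
      \<open>x\<close> needs an element of order \<open>0\<close> only, and \<open>1\<close> is
      one.\<close>
    have "\<exists>y. \<sigma> y = h" for h
      by (rule range_if_X_power_dvd[where n = 0 and x = x and e = 1 and s = "\<lambda>_. 1"])
         (use \<open>x \<noteq> 0\<close> \<open>e = 1\<close> in \<open>auto simp: e_def\<close>)
    then show ?thesis by (metis surj_def)
  qed
qed

text \<open>
  The values of \<open>D\<close> at \<open>x\<close> and at an element of minimal value force \<open>D\<close> to preserve values, so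
  \<open>D\<close> reproduces leading terms up to nonzero scalars.
\<close>

lemma mem_if_D_attains_minimal_value:
  assumes min: "\<And>y. y \<noteq> 0 \<Longrightarrow> \<sigma> y $ 0 = 0 \<Longrightarrow> subdegree (\<sigma> x0) \<le> subdegree (\<sigma> y)"
    and x0: "x0 \<noteq> 0" "\<sigma> x0 $ 0 = 0"
    and D: "\<And>y. \<sigma> (D y) $ 0 = 0"
    and x: "D x \<noteq> 0" "subdegree (\<sigma> (D x)) = subdegree (\<sigma> x0)"
    and J_add: "\<And>a b. a \<in> J \<Longrightarrow> b \<in> J \<Longrightarrow> a + b \<in> J"
    and J_mult: "\<And>a b. a \<in> J \<Longrightarrow> b * a \<in> J"
    and J_D: "\<And>y. D y \<in> J"
    and z: "\<sigma> z $ 0 = 0"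
  shows "z \<in> J"
proof (rule subdegree_D)
  assume "\<And>y. D y = 0"
  then show ?thesis using x by simp
next
  fix n g
  assume cond: "\<And>h. fps_X ^ n dvd h \<Longrightarrow> h \<in> range \<sigma>"
    and shift: "\<And>y. subdegree (\<sigma> y) > 0 \<Longrightarrow> D y \<noteq> 0 \<and> subdegree (\<sigma> (D y)) + n = g + subdegree (\<sigma> y)"
  have pos: "subdegree (\<sigma> y) > 0" if "y \<noteq> 0" "\<sigma> y $ 0 = 0" for y
    using that by (intro gr0I) (simp add: subdegree_eq_0_iff)
  define x' where "x' = x - \<kappa> (\<sigma> x $ 0)"
  have Dx': "D x' = D x" by (simp add: x'_def D_diff D_const)
  have x': "\<sigma> x' $ 0 = 0" "x' \<noteq> 0"
    using x Dx' D_0 by (auto simp: x'_def)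
  \<comment> \<open>\<open>D x'\<close> has the minimal order, so the shift \<open>g - n\<close> is
    not positive; conversely \<open>D x0\<close> has at least the minimal order, so it is not
    negative.\<close>
  have "g \<le> n"
    using shift[OF pos[OF x'(2,1)]] min[OF x'(2,1)] x by (simp add: Dx')
  moreover have "n \<le> g"
  proof -
    have "D x0 \<noteq> 0" "subdegree (\<sigma> (D x0)) + n = g + subdegree (\<sigma> x0)"
      using shift[OF pos[OF x0]] by auto
    with min[OF \<open>D x0 \<noteq> 0\<close> D] show ?thesis by simp
  qed
  ultimately have D_value: "D y \<noteq> 0 \<and> subdegree (\<sigma> (D y)) = subdegree (\<sigma> y)"
    if "subdegree (\<sigma> y) > 0" for y
    using shift[OF that] by simp
  have J_0: "0 \<in> J" using J_D[of 0] D_0 by simp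
  define d where "d = subdegree (\<sigma> (D x))"
  \<comment> \<open>A scalar multiple of \<open>D u\<close>, which has the same order as the
    remainder \<open>u\<close>, cancels its leading term. Orders start at \<open>1\<close> because
    \<open>D_value\<close> speaks of positive orders.\<close>
  have approx: "\<exists>j\<in>J. fps_X ^ Suc K dvd \<sigma> (z - j)" for K
  proof (induction K)
    case 0
    then show ?case using z J_0
      by (intro bexI[of _ 0]) (auto simp: fps_X_power_dvd_iff simp del: power_Suc power_Suc0_right)
  next
    case (Suc K)
    then obtain j where j: "j \<in> J" "fps_X ^ Suc K dvd \<sigma> (z - j)" by blast
    show ?case
    proof (cases "fps_X ^ Suc (Suc K) dvd \<sigma> (z - j)")
      case True
      with j show ?thesis by blast
    next
      case False
      let ?u = "z - j"
      have "?u \<noteq> 0" using False by auto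
      then have u: "subdegree (\<sigma> ?u) = Suc K"
        using False j(2)
        by (intro subdegreeI) (auto simp: fps_X_power_dvd_iff less_Suc_eq simp del: power_Suc)
      from D_value[of ?u] u have Du: "D ?u \<noteq> 0" "subdegree (\<sigma> (D ?u)) = Suc K" by simp_all
      from cancel_leading_term[OF j(2) Du]
      obtain c where "fps_X ^ Suc (Suc K) dvd \<sigma> ?u - \<sigma> (\<kappa> c * D ?u)" ..
      then have "fps_X ^ Suc (Suc K) dvd \<sigma> (z - (j + \<kappa> c * D ?u))"
        by (simp add: algebra_simps)
      moreover have "j + \<kappa> c * D ?u \<in> J"
        by (intro J_add J_mult J_D j(1))
      ultimately show ?thesis by blast
    qed
  qed
  \<comment> \<open>Finitely many steps suffice: a remainder of order above \<open>n + d\<close> is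
    \<open>D x\<close> times a series of order at least \<open>n\<close>, which comes from the
    ring.\<close>
  from approx[of "n + d"] obtain j where j: "j \<in> J" "fps_X ^ Suc (n + d) dvd \<sigma> (z - j)"
    by blast
  have "\<sigma> (D x) * fps_X ^ n dvd fps_X ^ Suc (n + d)"
    using x(1) by (subst fps_dvd_iff) (auto simp: fps_X_power_subdegree d_def simp del: power_Suc)
  then have "\<sigma> (D x) * fps_X ^ n dvd \<sigma> (z - j)"
    using j(2) by (rule dvd_trans)
  then obtain q where q: "\<sigma> (z - j) = \<sigma> (D x) * fps_X ^ n * q" ..
  obtain w where w: "\<sigma> w = fps_X ^ n * q"
    using cond[of "fps_X ^ n * q"] by auto
  have "z - j = w * D x"
    by (simp only: eq_iff[symmetric] q mult w) (simp add: algebra_simps)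
  then have "z = j + w * D x" by (simp add: algebra_simps)
  then show ?thesis by (simp add: J_add J_mult J_D j(1))
qed

end

section \<open>The normalization\<close>

lemma to_fract_in_integral_closure: "to_fract y \<in> integral_closure TYPE('r::idom)"
proof -
  have "coeff [:- to_fract y, 1:] i \<in> range to_fract" for i
    by (cases i) (auto simp: coeff_pCons split: nat.splits
        intro: range_eqI[of _ _ "- y"] range_eqI[of _ _ 0] range_eqI[of _ _ 1])
  then show ?thesis
    unfolding integral_closure_def by (intro CollectI exI[of _ "[:- to_fract y, 1:]"]) auto
qed

text \<open>An element outside the maximal ideal is a unit, so its constant term is nonzero.
  Conversely, for a member \<open>y\<close> with constant term \<open>c \<noteq> 0\<close>, also
  \<open>y - \<kappa> c\<close> would be a member, which puts the unit \<open>\<kappa> c\<close>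
  into the ideal.\<close>

lemma max_ideal_constant_term:
  fixes \<sigma> :: "'r::comm_ring_1 \<Rightarrow> 'k::field fps"
  assumes "noetherian_ring (ring_of_type_algebra :: 'r ring)" "local_ring (ring_of_type_algebra :: 'r ring)"
    and add: "\<And>a b. \<sigma> (a + b) = \<sigma> a + \<sigma> b" and mult: "\<And>a b. \<sigma> (a * b) = \<sigma> a * \<sigma> b"
    and one: "\<sigma> 1 = 1" and const: "\<And>c. \<sigma> (\<kappa> c) = fps_const c"
    and \<kappa>: "\<And>c d. \<kappa> (c * d) = \<kappa> c * \<kappa> d" "\<kappa> 1 = 1"
  shows "y \<in> max_ideal ring_of_type_algebra \<longleftrightarrow> \<sigma> y $ 0 = 0"
proof -
  let ?M = "max_ideal (ring_of_type_algebra :: 'r ring)"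
  have unit: "\<sigma> a $ 0 \<noteq> 0" if a: "a \<notin> ?M" for a
  proof -
    obtain b where "1 = a * b"
      using dvd_1_if_not_in_max_ideal[OF assms(1,2) a] unfolding dvd_def by blast
    then have "1 = \<sigma> a * \<sigma> b" by (metis mult one)
    then have "1 = \<sigma> a $ 0 * \<sigma> b $ 0" by (metis fps_mult_nth_0 fps_one_nth)
    then show ?thesis by auto
  qed
  interpret M: maximalideal ?M "ring_of_type_algebra :: 'r ring"
    by (rule maximalideal_max_ideal) (rule assms)
  have M: "a - b \<in> ?M" "r * a \<in> ?M" if "a \<in> ?M" "b \<in> ?M" for a b r
  proof -
    have I: "a \<in> ?M \<Longrightarrow> b \<in> ?M \<Longrightarrow> a + b \<in> ?M" "a \<in> ?M \<Longrightarrow> r * a \<in> ?M" for a b r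
      using M.is_ideal by (simp_all add: ideal_ring_of_type_algebra_iff)
    from that I(1)[of a "-1 * b"] I(2)[of b "-1"] I(2)[of a r]
    show "a - b \<in> ?M" "r * a \<in> ?M" by simp_all
  qed
  have "\<sigma> y $ 0 = 0" if y: "y \<in> ?M"
  proof (rule ccontr)
    assume c: "\<sigma> y $ 0 \<noteq> 0"
    define c where "c = \<sigma> y $ 0"
    have "\<sigma> (y - \<kappa> c) + \<sigma> (\<kappa> c) = \<sigma> y" by (simp flip: add)
    then have "\<sigma> (y - \<kappa> c) = \<sigma> y - fps_const c" by (simp add: const algebra_simps)
    then have "\<sigma> (y - \<kappa> c) $ 0 = 0" by (simp add: c_def)
    then have "y - \<kappa> c \<in> ?M" using unit by blast
    from M(1)[OF y this] have "\<kappa> c \<in> ?M" by simp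
    from M(2)[OF this y, of "\<kappa> (inverse c)"] have "1 \<in> ?M"
      using c \<kappa> by (metis c_def left_inverse)
    then show False
      using M.one_imp_carrier M.I_notcarr by simp
  qed
  with unit show ?thesis by blast
qed

section \<open>Regularity and orders of ideals\<close>

context branch
begin

lemma ideal_X_power_dvd: "ideal {y. fps_X ^ n dvd \<sigma> y} ring_of_type_algebra"
  by (auto simp: ideal_ring_of_type_algebra_iff)

lemma regular_if_surj:
  assumes "noetherian_ring (ring_of_type_algebra :: 'r ring)" "local_ring (ring_of_type_algebra :: 'r ring)"
    and dim: "krull_dim (ring_of_type_algebra :: 'r ring) = 1"
    and max_ideal: "\<And>y. y \<in> max_ideal ring_of_type_algebra \<longleftrightarrow> \<sigma> y $ 0 = 0"
    and surj: "surj \<sigma>"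
  shows "regular_local_ring (ring_of_type_algebra :: 'r ring)"
proof -
  let ?R = "ring_of_type_algebra :: 'r ring"
  obtain x where x: "\<sigma> x = fps_X" using surj by (metis surjD)
  have "genideal ?R {x} = max_ideal ?R"
  proof
    have "ideal (max_ideal ?R) ?R"
      by (rule maximalideal.axioms(1)) (rule maximalideal_max_ideal, fact)
    then show "genideal ?R {x} \<subseteq> max_ideal ?R"
      by (subst genideal_subset_iff) (simp_all add: max_ideal x)
    show "max_ideal ?R \<subseteq> genideal ?R {x}"
    proof
      fix y assume "y \<in> max_ideal ?R"
      then have "fps_X dvd \<sigma> y"
        using fps_X_power_dvd_iff[of 1 "\<sigma> y"] by (simp add: max_ideal)
      then obtain h where "\<sigma> y = fps_X * h" ..
      moreover obtain w where "\<sigma> w = h" using surj by (metis surjD)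
      ultimately have "y = w * x" by (simp add: x mult.commute flip: eq_iff)
      moreover have "x \<in> genideal ?R {x}" using genideal_superset by fast
      ultimately show "y \<in> genideal ?R {x}"
        using ideal_genideal_ring_of_type_algebra[of "{x}"]
        by (simp add: ideal_ring_of_type_algebra_iff)
    qed
  qed
  moreover have "enat (card {x}) = krull_dim ?R" by (simp add: dim one_enat_def)
  ultimately show ?thesis
    unfolding regular_local_ring_def using assms(1,2)
    by (intro conjI exI[of _ "{x}"]) auto
qed

lemma enat_le_fps_order_iff: "enat n \<le> fps_order h \<longleftrightarrow> fps_X ^ n dvd (h :: 'k fps)"
  by (auto simp: fps_order_def fps_dvd_iff fps_X_power_subdegree)

lemma enat_le_order_iff:
  "enat n \<le> (INF y\<in>J. fps_order (\<sigma> y)) \<longleftrightarrow> (\<forall>y\<in>J. fps_X ^ n dvd \<sigma> y)"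
  by (simp add: le_INF_iff enat_le_fps_order_iff)

lemma exists_order_eq:
  assumes "(INF y\<in>J. fps_order (\<sigma> y)) = enat e"
  shows "\<exists>y\<in>J. y \<noteq> 0 \<and> subdegree (\<sigma> y) = e"
proof -
  have dvd: "\<forall>y\<in>J. fps_X ^ e dvd \<sigma> y"
    using enat_le_order_iff[of e J] assms by simp
  have "\<not> enat (Suc e) \<le> (INF y\<in>J. fps_order (\<sigma> y))" using assms by simp
  then obtain y where y: "y \<in> J" "\<not> fps_X ^ Suc e dvd \<sigma> y"
    unfolding enat_le_order_iff by blast
  then have "y \<noteq> 0" by auto
  moreover have "subdegree (\<sigma> y) = e"
    using y dvd by (intro subdegreeI) (auto simp: fps_X_power_dvd_iff less_Suc_eq simp del: power_Suc)
  ultimately show ?thesis using y(1) by blast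
qed

text \<open>The elements of order at least \<open>n\<close> form an ideal, which contains
  \<open>S\<close> exactly when it contains the ideal generated by \<open>S\<close>; so both infima
  have the same finite lower bounds.\<close>

lemma order_genideal:
  "(INF y\<in>genideal ring_of_type_algebra S. fps_order (\<sigma> y)) = (INF y\<in>S. fps_order (\<sigma> y))"
proof -
  have *: "enat n \<le> (INF y\<in>genideal ring_of_type_algebra S. fps_order (\<sigma> y)) \<longleftrightarrow>
      enat n \<le> (INF y\<in>S. fps_order (\<sigma> y))" for n
    using genideal_subset_iff[OF ideal_X_power_dvd, of S n]
    unfolding enat_le_order_iff by blast
  have le: "a \<le> b" if "\<And>n. enat n \<le> a \<Longrightarrow> enat n \<le> b" for a b :: enat
  proof (cases a)
    case infinity
    then have "b = \<infinity>" using that by (cases b) (metis Suc_n_not_le_n enat_ord_code(3) enat_ord_simps(1))+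
    then show ?thesis by simp
  qed (use that in auto)
  show ?thesis by (rule antisym) (rule le, simp add: *)+
qed

end

text \<open>The uniformizer comes from the fraction field, hence is a quotient of two ring elements.
  Convergence follows from adic completeness, as the maximal ideal maps into the multiples of
  \<open>fps_X\<close>.\<close>

lemma branch_of_normalization:
  fixes \<psi> :: "'r::idom fract \<Rightarrow> 'k::field_char_0 fps" and \<kappa> :: "'k \<Rightarrow> 'r"
  defines "R \<equiv> ring_of_type_algebra :: 'r ring"
  assumes "noetherian_ring R" "local_ring R"
    and complete: "adically_complete R (max_ideal R)"
    and \<kappa>: "\<kappa> \<in> ring_hom ring_of_type_algebra R"
    and normalization: "\<psi> \<in> ring_iso (integral_closure_ring TYPE('r)) ring_of_type_algebra"
      "\<And>c. \<psi> (to_fract (\<kappa> c)) = fps_const c"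
  shows "branch (\<lambda>y. \<psi> (to_fract y)) \<kappa>"
    and "y \<in> max_ideal R \<longleftrightarrow> \<psi> (to_fract y) $ 0 = 0"
proof -
  define \<sigma> where "\<sigma> y = \<psi> (to_fract y)" for y
  let ?C = "integral_closure TYPE('r)"
  have \<psi>_add: "\<psi> (a + b) = \<psi> a + \<psi> b" and \<psi>_mult: "\<psi> (a * b) = \<psi> a * \<psi> b" if "a \<in> ?C" "b \<in> ?C" for a b
    using normalization(1) that
    by (auto simp: ring_iso_def ring_hom_def integral_closure_ring_def ring_of_type_algebra_def)
  have \<psi>_1: "\<psi> 1 = 1" and bij: "bij_betw \<psi> ?C UNIV"
    using normalization(1)
    by (auto simp: ring_iso_def ring_hom_def integral_closure_ring_def ring_of_type_algebra_def)
  note C = to_fract_in_integral_closure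
  have add: "\<sigma> (a + b) = \<sigma> a + \<sigma> b" and mult: "\<sigma> (a * b) = \<sigma> a * \<sigma> b" and one: "\<sigma> 1 = 1" for a b
    by (simp_all add: \<sigma>_def \<psi>_add \<psi>_mult \<psi>_1 C)
  have const: "\<sigma> (\<kappa> c) = fps_const c" for c
    by (simp add: \<sigma>_def normalization)
  have zero: "\<sigma> 0 = 0" using add[of 0 0] by simp
  have diff: "\<sigma> (a - b) = \<sigma> a - \<sigma> b" for a b
    by (metis add add_diff_cancel_right' diff_add_cancel)
  have max_ideal: "y \<in> max_ideal R \<longleftrightarrow> \<sigma> y $ 0 = 0" for y
    unfolding R_def
    by (rule max_ideal_constant_term[where \<kappa> = \<kappa>])
       (use assms(2,3) \<kappa> add mult one const in \<open>auto simp: R_def ring_hom_def\<close>)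
  then show "y \<in> max_ideal R \<longleftrightarrow> \<psi> (to_fract y) $ 0 = 0"
    by (simp add: \<sigma>_def)
  have inj: "a = 0" if "\<sigma> a = 0" for a
  proof -
    have "\<psi> (to_fract a) = \<psi> (to_fract 0)" using that zero by (simp only: \<sigma>_def)
    then have "to_fract a = to_fract 0"
      using bij C by (metis bij_betw_imp_inj_on inj_onD)
    then show ?thesis by simp
  qed
  have "\<exists>a b. b \<noteq> 0 \<and> \<sigma> a = fps_X * \<sigma> b"
  proof -
    have "fps_X \<in> \<psi> ` ?C" using bij by (simp add: bij_betw_imp_surj_on)
    then obtain q where q: "fps_X = \<psi> q" "q \<in> ?C" by blast
    obtain a b where ab: "q = Fract a b" "b \<noteq> 0" by (cases q) auto
    then have "to_fract a = q * to_fract b" by (simp add: Fract_conv_to_fract)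
    then have "\<sigma> a = fps_X * \<sigma> b" by (simp add: \<sigma>_def q \<psi>_mult C)
    with ab show ?thesis by blast
  qed
  moreover have "\<exists>y. \<forall>k. fps_X ^ k dvd \<sigma> y - \<sigma> (\<Sum>j<k. x ^ j * w j)" if x: "\<sigma> x $ 0 = 0" for x w
  proof -
    let ?s = "\<lambda>k. \<Sum>j<k. x ^ j * w j"
    have "x \<in> max_ideal R" using x max_ideal by simp
    then have "?s k \<in> carrier R \<and> ?s (Suc k) \<ominus>\<^bsub>R\<^esub> ?s k \<in> max_ideal R [^]\<^bsub>ideals_set R\<^esub> k" for k
      by (simp add: R_def power_mult_in_ideal_power)
    then have "\<exists>!y. y \<in> carrier R \<and> (\<forall>k. y \<ominus>\<^bsub>R\<^esub> ?s k \<in> max_ideal R [^]\<^bsub>ideals_set R\<^esub> k)"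
      by (intro complete[unfolded adically_complete_def, rule_format, of ?s])
    then obtain y where y: "\<And>k. y \<ominus>\<^bsub>R\<^esub> ?s k \<in> max_ideal R [^]\<^bsub>ideals_set R\<^esub> k"
      by blast
    have "fps_X ^ k dvd \<sigma> y - \<sigma> (?s k)" for k
    proof -
      have "fps_X ^ k dvd \<sigma> (y - ?s k)"
      proof (rule dvd_if_in_ideal_power[OF add mult])
        show "y - ?s k \<in> max_ideal R [^]\<^bsub>ideals_set ring_of_type_algebra\<^esub> k"
          using y[of k] by (simp add: R_def)
        show "fps_X dvd \<sigma> a" if "a \<in> max_ideal R" for a
          using that fps_X_power_dvd_iff[of 1 "\<sigma> a"] by (simp add: max_ideal)
      qed
      then show ?thesis by (simp add: diff)
    qed
    then show ?thesis by blast
  qed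
  ultimately have "branch \<sigma> \<kappa>"
    by unfold_locales (use add mult one const inj in auto)
  then show "branch (\<lambda>y. \<psi> (to_fract y)) \<kappa>"
    by (simp add: \<sigma>_def[abs_def])
qed

unbundle vec_syntax

section \<open>Quasihomogeneity and the order of the trace ideal\<close>

theorem theorem2:
  fixes R :: "'r::idom ring"
    and P :: "('k::{alg_closed_field, field_char_0}, 'n::finite) mfps ring"
    and \<kappa> :: "'k \<Rightarrow> 'r"
    and \<phi> :: "('k, 'n) mfps \<Rightarrow> 'r"
    and f :: "('k, 'n) mfps ^ 'm::finite"
    and \<psi> :: "'r fract \<Rightarrow> 'k fps"
  assumes R: "R = ring_of_type_algebra"
    and P: "P = ring_of_type_algebra"
    \<comment> \<open>\<open>R\<close> is a one-dimensional non-regular complete Noetherian local domain\<close>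
    and noetherian: "noetherian_domain R"
    and local: "local_ring R"
    and complete: "adically_complete R (max_ideal R)"
    and dim: "krull_dim R = 1"
    and non_regular: "\<not> regular_local_ring R"
    \<comment> \<open>which is a \<open>k\<close>-algebra with residue field \<open>k\<close>\<close>
    and algebra: "\<kappa> \<in> ring_hom ring_of_type_algebra R"
    and residue_field: "(\<lambda>c. max_ideal R +>\<^bsub>R\<^esub> \<kappa> c) \<in> ring_iso ring_of_type_algebra (R Quot max_ideal R)"
    \<comment> \<open>\<open>R\<close> is the quotient of \<open>P\<close> by the prime ideal generated by the components of \<open>f\<close>\<close>
    and vars: "CARD('n) \<ge> 2"
    and proj: "\<phi> \<in> ring_hom P R" "\<phi> ` carrier P = carrier R" "\<And>c. \<phi> (mfps_const c) = \<kappa> c"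
    and kernel: "a_kernel P R \<phi> = genideal P (range (($) f))"
    and prime: "primeideal (genideal P (range (($) f))) P"
    and minimal: "genideal P (range (($) f)) \<subseteq> (genideal P (range mfps_X)) [^]\<^bsub>ideals_set P\<^esub> (2::nat)"
    \<comment> \<open>\<open>\<psi>\<close> identifies the integral closure of \<open>R\<close> with the power series ring over \<open>k\<close>\<close>
    and normalization: "\<psi> \<in> ring_iso (integral_closure_ring TYPE('r)) ring_of_type_algebra"
      "\<And>c. \<psi> (to_fract (\<kappa> c)) = fps_const c"
  shows "quasihomogeneous \<phi> f \<longleftrightarrow>
    ideal_order \<psi> (trace_ideal R (differentials \<phi> f)) = ideal_order \<psi> (max_ideal R)"
proof -
  let ?\<sigma> = "\<lambda>y. \<psi> (to_fract y)" and ?M = "max_ideal R" and ?\<Omega> = "differentials \<phi> f"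
  have noeth: "noetherian_ring R"
    using noetherian by (simp add: noetherian_domain_def)
  note normalization' = branch_of_normalization[OF noeth[unfolded R] local[unfolded R] complete[unfolded R]
      algebra[unfolded R] normalization, folded R]
  interpret branch ?\<sigma> \<kappa> by (rule normalization'(1))
  have M: "y \<in> ?M \<longleftrightarrow> fps_nth (?\<sigma> y) 0 = 0" for y by (rule normalization'(2))
  have M_ideal: "ideal ?M R"
    using maximalideal_max_ideal[OF local] by (rule maximalideal.axioms(1))
  note M_ideal' = M_ideal[unfolded R ideal_ring_of_type_algebra_iff, folded R]
  have \<phi>: "\<phi> \<in> ring_hom ring_of_type_algebra ring_of_type_algebra" "surj \<phi>"
    using proj(1,2) by (simp_all add: R P)
  define H where "H = (\<Union>\<alpha>\<in>module_Hom R ?\<Omega> (ideal_module R (carrier R)). \<alpha> ` carrier ?\<Omega>)"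
  have trace: "trace_ideal R ?\<Omega> = genideal R H"
    by (simp add: trace_ideal_def H_def)
  have Hom_mono: "module_Hom R ?\<Omega> (ideal_module R I) \<subseteq> module_Hom R ?\<Omega> (ideal_module R J)" if "I \<subseteq> J" for I J
    using that by (auto simp: module_Hom_def ideal_module_def)
  have derivation: thesis
    if \<alpha>: "\<alpha> \<in> module_Hom R ?\<Omega> (ideal_module R I)"
      and thesis: "\<And>D. branch_derivation ?\<sigma> \<kappa> D \<Longrightarrow> \<alpha> ` carrier ?\<Omega> = genideal R (range D) \<Longrightarrow> thesis"
    for \<alpha> I thesis
  proof (rule derivation_of_module_Hom[OF \<phi> kernel[unfolded P R] \<alpha>[unfolded R]])
    fix D assume D: "\<And>a b. D (a + b) = D a + D b" "\<And>a b. D (a * b) = a * D b + b * D a"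
      "\<And>c. D (\<phi> (mfps_const c)) = 0" "\<alpha> ` carrier ?\<Omega> = genideal ring_of_type_algebra (range D)"
    have "branch_derivation ?\<sigma> \<kappa> D"
      by unfold_locales (use D(1-3) proj(3) in auto)
    then show thesis using thesis D(4) by (simp add: R)
  qed
  show ?thesis
  proof
    assume "quasihomogeneous \<phi> f"
    then obtain \<alpha> where \<alpha>: "\<alpha> \<in> module_Hom R ?\<Omega> (ideal_module R ?M)" "\<alpha> ` carrier ?\<Omega> = ?M"
      unfolding quasihomogeneous_def R by (auto simp: Let_def)
    \<comment> \<open>A surjection onto the maximal ideal is also a homomorphism into
      \<open>R\<close>.\<close>
    have "?M \<subseteq> H"
      using \<alpha> Hom_mono[of ?M "carrier R"] by (force simp: H_def R)
    then have "?M \<subseteq> genideal R H"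
      using genideal_superset by (rule subset_trans)
    moreover have "H \<subseteq> ?M"
    proof -
      have "\<alpha> ` carrier ?\<Omega> \<subseteq> ?M" if "\<alpha> \<in> module_Hom R ?\<Omega> (ideal_module R (carrier R))" for \<alpha>
      proof (rule derivation[OF that])
        fix D assume D: "branch_derivation ?\<sigma> \<kappa> D" "\<alpha> ` carrier ?\<Omega> = genideal R (range D)"
        have "D y \<in> ?M" for y
        proof (rule ccontr)
          assume "D y \<notin> ?M"
          then have "surj ?\<sigma>"
            using branch_derivation.surj_if_D_unit[OF D(1), of y] M by blast
          then have "regular_local_ring R"
            using regular_if_surj[OF noeth[unfolded R] local[unfolded R] dim[unfolded R]] M by (simp add: R)
          with non_regular show False by simp
        qed
        then show ?thesis
          unfolding D(2) using M_ideal by (simp add: R genideal_subset_iff image_subset_iff)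
      qed
      then show ?thesis by (auto simp: H_def)
    qed
    then have "genideal R H \<subseteq> ?M"
      using M_ideal by (simp add: R genideal_subset_iff)
    ultimately have "trace_ideal R ?\<Omega> = ?M"
      unfolding trace by blast
    then show "ideal_order \<psi> (trace_ideal R ?\<Omega>) = ideal_order \<psi> ?M" by simp
  next
    assume eq: "ideal_order \<psi> (trace_ideal R ?\<Omega>) = ideal_order \<psi> ?M"
    \<comment> \<open>The numerator \<open>a\<close> of the uniformizer is a nonzero element of the
      maximal ideal, whose order is therefore finite.\<close>
    obtain a b where ab: "b \<noteq> 0" "?\<sigma> a = fps_X * ?\<sigma> b" using uniformizer by blast
    then have "a \<noteq> 0" by (metis eq_0_iff fps_X_neq_zero mult_eq_0_iff)
    moreover have "a \<in> ?M" by (simp add: M ab)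
    ultimately have "ideal_order \<psi> ?M \<le> enat (subdegree (?\<sigma> a))"
      unfolding ideal_order_def by (intro INF_lower2[of a]) (auto simp: fps_order_def)
    then obtain e where e: "ideal_order \<psi> ?M = enat e" by (cases "ideal_order \<psi> ?M") auto
    obtain x0 where x0: "x0 \<in> ?M" "x0 \<noteq> 0" "subdegree (?\<sigma> x0) = e"
      using exists_order_eq[OF e[unfolded ideal_order_def]] by blast
    have e_pos: "e > 0"
      using x0 M by (intro gr0I) (simp add: subdegree_eq_0_iff)
    have M_min: "e \<le> subdegree (?\<sigma> y)" if "y \<in> ?M" "y \<noteq> 0" for y
      using e[unfolded ideal_order_def] enat_le_order_iff[of e ?M] that
      by (auto intro: fps_X_power_dvd_subdegree)
    \<comment> \<open>Passing to the generators of the trace ideal ensures that the order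
      \<open>e\<close> is attained by a value of a single homomorphism, not only by a sum.\<close>
    have H_order: "(INF y\<in>H. fps_order (?\<sigma> y)) = enat e"
      using eq order_genideal[of H] unfolding e by (simp add: trace ideal_order_def flip: R)
    have H_M: "H \<subseteq> ?M"
    proof
      fix y assume "y \<in> H"
      then have "fps_X ^ e dvd ?\<sigma> y" using enat_le_order_iff[of e H] H_order by simp
      then show "y \<in> ?M" using e_pos by (simp add: M fps_X_power_dvd_iff)
    qed
    obtain z where z: "z \<in> H" "z \<noteq> 0" "subdegree (?\<sigma> z) = e"
      using exists_order_eq[OF H_order] by blast
    obtain \<alpha> where \<alpha>: "\<alpha> \<in> module_Hom R ?\<Omega> (ideal_module R (carrier R))" "z \<in> \<alpha> ` carrier ?\<Omega>"
      using z(1) by (auto simp: H_def)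
    have \<alpha>_M: "\<alpha> ` carrier ?\<Omega> \<subseteq> ?M"
      using \<alpha>(1) H_M by (auto simp: H_def)
    have "?M \<subseteq> \<alpha> ` carrier ?\<Omega>"
    proof (rule derivation[OF \<alpha>(1)])
      fix D assume D: "branch_derivation ?\<sigma> \<kappa> D" and image: "\<alpha> ` carrier ?\<Omega> = genideal R (range D)"
      have D_image: "D y \<in> \<alpha> ` carrier ?\<Omega>" for y
        unfolding image by (rule subsetD[OF genideal_superset]) simp
      have D_M: "D y \<in> ?M" for y using D_image \<alpha>_M by blast
      \<comment> \<open>If all values of \<open>D\<close> had order above \<open>e\<close>, so would
        every element of the ideal they generate, including \<open>z\<close>.\<close>
      have "\<not> fps_X ^ Suc e dvd ?\<sigma> z"
        using z fps_X_power_dvd_subdegree[of "Suc e" "?\<sigma> z"] by auto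
      then have "\<not> range D \<subseteq> {y. fps_X ^ Suc e dvd ?\<sigma> y}"
        using \<alpha>(2) genideal_subset_iff[OF ideal_X_power_dvd, of "range D" "Suc e"] by (auto simp: image R)
      then obtain x where x: "\<not> fps_X ^ Suc e dvd ?\<sigma> (D x)" by blast
      then have Dx: "D x \<noteq> 0" using zero by auto
      have Dx_order: "subdegree (?\<sigma> (D x)) = e"
      proof (rule antisym)
        show "subdegree (?\<sigma> (D x)) \<le> e"
          using x Dx by (simp add: fps_dvd_iff fps_X_power_subdegree eq_0_iff del: power_Suc)
        show "e \<le> subdegree (?\<sigma> (D x))" by (rule M_min[OF D_M Dx])
      qed
      let ?J = "genideal R (range D)"
      have J: "ideal ?J ring_of_type_algebra"
        unfolding R by (rule ideal_genideal_ring_of_type_algebra)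
      have "y \<in> ?J" if y: "y \<in> ?M" for y
      proof (rule branch_derivation.mem_if_D_attains_minimal_value[OF D, of x0 x])
        show "x0 \<noteq> 0" "D x \<noteq> 0" by fact+
        show "subdegree (?\<sigma> (D x)) = subdegree (?\<sigma> x0)" by (simp only: Dx_order x0(3))
        show "subdegree (?\<sigma> x0) \<le> subdegree (?\<sigma> y)" if "y \<noteq> 0" "fps_nth (?\<sigma> y) 0 = 0" for y
          using M_min[of y] that unfolding x0(3) M by blast
        show "a + b \<in> ?J" if "a \<in> ?J" "b \<in> ?J" for a b
          using J that unfolding ideal_ring_of_type_algebra_iff by blast
        show "b * a \<in> ?J" if "a \<in> ?J" for a b
          using J that unfolding ideal_ring_of_type_algebra_iff by blast
        show "D y \<in> ?J" for y using D_image unfolding image .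
        show "fps_nth (?\<sigma> (D y)) 0 = 0" for y using D_M unfolding M .
        show "fps_nth (?\<sigma> x0) 0 = 0" "fps_nth (?\<sigma> y) 0 = 0" using x0(1) y unfolding M .
      qed
      then show ?thesis unfolding image by blast
    qed
    with \<alpha>_M have "\<alpha> ` carrier ?\<Omega> = ?M" by blast
    moreover from this have "\<alpha> \<in> module_Hom R ?\<Omega> (ideal_module R ?M)"
      using \<alpha>(1) by (auto simp: module_Hom_def ideal_module_def)
    ultimately show "quasihomogeneous \<phi> f"
      unfolding quasihomogeneous_def Let_def R[symmetric] by blast
  qed
qed

end
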